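(* Let $\mathcal{G}$ be a transitive groupoid, fix $b\in\mathcal{G}^0$, and suppose that $t|_{\mathcal{G}_b}\colon\mathcal{G}_b\to\mathcal{G}^0$ admits local sections. If $\pi\colon P\to M$ is a principal $\mathcal{G}$-bundle with anchor map $\epsilon$ such that $b\in\epsilon(P)$, then the restriction $\pi|_{P_b}\colon P_b\to M$ is a principal $\mathcal{G}_b^b$-bundle. Conversely, if $\pi_b\colon P_b\to M$ is a principal $\mathcal{G}_b^b$-bundle, then we can extend $\pi_b$ to a principal $\mathcal{G}$-bundle $\pi'\colon P'\to M$. Moreover, these operations (restriction and extension) are inverses of each other up to isomorphisms of principal bundles.
   Context: All spaces are Hausdorff and compactly generated, all maps are continuous, and all groupoids are topological groupoids. A topological groupoid $\mathcal{G}$ has an object space $\mathcal{G}^0$ and an arrow space $\mathcal{G}^1$, both Hausdorff, with continuous structure maps (identity $i\colon\mathcal{G}^0\to\mathcal{G}^1$, source $s$ and target $t\colon\mathcal{G}^1\to\mathcal{G}^0$, inverse, and composition $gh:=g\circ h$, defined when $s(g)=t(h)$), and $s$ (hence $t$) is open. It is transitive if its orbit space $\mathcal{G}^0/\mathcal{G}^1$ is a single point. For $b\in\mathcal{G}^0$: $\mathcal{G}_b^b=\{g\in\mathcal{G}^1\mid s(g)=t(g)=b\}$ is the stabilizer group of $b$, and $\mathcal{G}_b=\{g\in\mathcal{G}^1\mid s(g)=b\}$ is the source fiber of $b$. A right $\mathcal{G}$-space is a space $X$ with an anchor map $a_X\colon X\to\mathcal{G}^0$ and a continuous action $(x,g)\mapsto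 xg$, defined when $a_X(x)=t(g)$, such that $a_X(xg)=s(g)$, $x\,i(a_X(x))=x$, and $(xg)g'=x(gg')$ whenever defined. A map admits local sections if every point of its codomain has an open neighborhood on which a continuous section is defined. A principal $\mathcal{G}$-bundle over a Hausdorff paracompact space $M$ is a paracompact space $P$ with a surjective map $\pi\colon P\to M$ and a right $\mathcal{G}$-action with anchor map $\epsilon\colon P\to\mathcal{G}^0$ such that (1) $\pi$ has local sections; (2) $\pi(pg)=\pi(p)$ for all $p\in P$ and $g\in\mathcal{G}^1$ with $\epsilon(p)=t(g)$; (3) the map $\{(p,g)\in P\times\mathcal{G}^1\mid\epsilon(p)=t(g)\}\to P\times_M P$, $(p,g)\mapsto(p,pg)$, is a homeomorphism. For a topological group, viewed as a groupoid with one object, this is the usual notion of principal bundle. For a principal $\mathcal{G}$-bundle $P$ with anchor map $\epsilon$, $P_b$ denotes the anchor fiber $\epsilon^{-1}(b)$, on which the $\mathcal{G}$-action restricts to a right $\mathcal{G}_b^b$-action. In the converse direction, $P_b$ denotes the total space of the given principal $\mathcal{G}_b^b$-bundle. An isomorphism of principal bundles over $M$ is an equivariant homeomorphism (compatible with anchor maps and actions) commuting with the projections to $M$.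
   Formalization: In the converse, the extension P' is shown to satisfy every condition of a principal G-bundle except paracompactness of P', which is an added assumption there; it can fail, e.g. for the pair groupoid of the long line over a point. *)

theory Defs
  imports "HOL-Analysis.Analysis"
begin

section \<open>Topological preliminaries\<close>

text \<open>
  All spaces are Hausdorff and compactly generated. Products are the products of that category,
  i.e. the kification of the product topology. Fibre products are closed subspaces of these
  products, because all spaces that occur are Hausdorff.
\<close>

definition cg_space :: "'x topology \<Rightarrow> bool" where
  "cg_space X \<longleftrightarrow> Hausdorff_space X \<and> k_space X"

definition kprod :: "'x topology \<Rightarrow> 'y topology \<Rightarrow> ('x \<times> 'y) topology" where
  "kprod X Y = kification (prod_topology X Y)"

definition paracompact_space :: "'x topology \<Rightarrow> bool" where
  "paracompact_space X \<longleftrightarrow>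
     (\<forall>\<U>. (\<forall>U\<in>\<U>. openin X U) \<and> \<Union>\<U> = topspace X \<longrightarrow>
       (\<exists>\<V>. (\<forall>V\<in>\<V>. openin X V \<and> (\<exists>U\<in>\<U>. V \<subseteq> U)) \<and> \<Union>\<V> = topspace X \<and>
            locally_finite_in X \<V>))"

definition quotient_topology :: "'x topology \<Rightarrow> ('x \<Rightarrow> 'y) \<Rightarrow> 'y topology" where
  "quotient_topology X f =
     topology (\<lambda>V. V \<subseteq> f ` topspace X \<and> openin X {x \<in> topspace X. f x \<in> V})"

lemma openin_quotient_topology:
  "openin (quotient_topology X f) V \<longleftrightarrow>
     V \<subseteq> f ` topspace X \<and> openin X {x \<in> topspace X. f x \<in> V}"
proof -
  let ?L = "\<lambda>V. V \<subseteq> f ` topspace X \<and> openin X {x \<in> topspace X. f x \<in> V}"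
  have "istopology ?L"
    unfolding istopology_def
  proof (intro conjI allI impI)
    fix S T assume S: "?L S" and T: "?L T"
    have "{x \<in> topspace X. f x \<in> S \<inter> T} =
        {x \<in> topspace X. f x \<in> S} \<inter> {x \<in> topspace X. f x \<in> T}"
      by auto
    with S T show "openin X {x \<in> topspace X. f x \<in> S \<inter> T}"
      by auto
    show "S \<inter> T \<subseteq> f ` topspace X"
      using S by auto
  next
    fix \<K> assume K: "\<forall>K\<in>\<K>. ?L K"
    have "{x \<in> topspace X. f x \<in> \<Union>\<K>} = \<Union>((\<lambda>K. {x \<in> topspace X. f x \<in> K}) ` \<K>)"
      by auto
    with K show "openin X {x \<in> topspace X. f x \<in> \<Union>\<K>}"
      by auto
    show "\<Union>\<K> \<subseteq> f ` topspace X"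
      using K by blast
  qed
  then show ?thesis
    by (simp add: quotient_topology_def topology_inverse')
qed

lemma topspace_quotient_topology [simp]: "topspace (quotient_topology X f) = f ` topspace X"
proof
  show "topspace (quotient_topology X f) \<subseteq> f ` topspace X"
    by (metis openin_quotient_topology openin_topspace)
  have "{x \<in> topspace X. f x \<in> f ` topspace X} = topspace X"
    by auto
  then have "openin (quotient_topology X f) (f ` topspace X)"
    by (simp add: openin_quotient_topology)
  then show "f ` topspace X \<subseteq> topspace (quotient_topology X f)"
    by (rule openin_subset)
qed

lemma quotient_map_quotient_topology: "quotient_map X (quotient_topology X f) f"
  by (simp add: quotient_map_def openin_quotient_topology)

definition admits_local_sections :: "'x topology \<Rightarrow> 'y topology \<Rightarrow> ('x \<Rightarrow> 'y) \<Rightarrow> bool" where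
  "admits_local_sections X Y f \<longleftrightarrow>
     (\<forall>y\<in>topspace Y. \<exists>U \<sigma>. openin Y U \<and> y \<in> U \<and>
        continuous_map (subtopology Y U) X \<sigma> \<and> (\<forall>u\<in>U. f (\<sigma> u) = u))"


section \<open>Topological groupoids\<close>

text \<open>
  \<open>cmp G g h\<close> is the composite of \<open>g\<close> after \<open>h\<close>; it is
  meaningful only when \<open>src G g = tgt G h\<close>.
\<close>

record ('o, 'a) groupoid =
  Obj :: "'o topology"
  Arr :: "'a topology"
  ident :: "'o \<Rightarrow> 'a"
  src :: "'a \<Rightarrow> 'o"
  tgt :: "'a \<Rightarrow> 'o"
  invs :: "'a \<Rightarrow> 'a"
  cmp :: "'a \<Rightarrow> 'a \<Rightarrow> 'a"

locale topological_groupoid =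
  fixes G :: "('o, 'a) groupoid"
  assumes cg_Obj: "cg_space (Obj G)"
    and cg_Arr: "cg_space (Arr G)"
    and continuous_ident: "continuous_map (Obj G) (Arr G) (ident G)"
    and continuous_src: "continuous_map (Arr G) (Obj G) (src G)"
    and continuous_tgt: "continuous_map (Arr G) (Obj G) (tgt G)"
    and continuous_invs: "continuous_map (Arr G) (Arr G) (invs G)"
    and continuous_cmp:
      "continuous_map (subtopology (kprod (Arr G) (Arr G)) {(g, h). src G g = tgt G h}) (Arr G)
         (\<lambda>(g, h). cmp G g h)"
    and open_src: "open_map (Arr G) (Obj G) (src G)"
    and src_ident: "x \<in> topspace (Obj G) \<Longrightarrow> src G (ident G x) = x"
    and tgt_ident: "x \<in> topspace (Obj G) \<Longrightarrow> tgt G (ident G x) = x"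
    and src_cmp:
      "\<lbrakk>g \<in> topspace (Arr G); h \<in> topspace (Arr G); src G g = tgt G h\<rbrakk>
        \<Longrightarrow> src G (cmp G g h) = src G h"
    and tgt_cmp:
      "\<lbrakk>g \<in> topspace (Arr G); h \<in> topspace (Arr G); src G g = tgt G h\<rbrakk>
        \<Longrightarrow> tgt G (cmp G g h) = tgt G g"
    and cmp_assoc:
      "\<lbrakk>g \<in> topspace (Arr G); h \<in> topspace (Arr G); k \<in> topspace (Arr G);
        src G g = tgt G h; src G h = tgt G k\<rbrakk>
        \<Longrightarrow> cmp G (cmp G g h) k = cmp G g (cmp G h k)"
    and cmp_ident_right: "g \<in> topspace (Arr G) \<Longrightarrow> cmp G g (ident G (src G g)) = g"
    and cmp_ident_left: "g \<in> topspace (Arr G) \<Longrightarrow> cmp G (ident G (tgt G g)) g = g"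
    and src_invs: "g \<in> topspace (Arr G) \<Longrightarrow> src G (invs G g) = tgt G g"
    and tgt_invs: "g \<in> topspace (Arr G) \<Longrightarrow> tgt G (invs G g) = src G g"
    and cmp_invs_right: "g \<in> topspace (Arr G) \<Longrightarrow> cmp G g (invs G g) = ident G (tgt G g)"
    and cmp_invs_left: "g \<in> topspace (Arr G) \<Longrightarrow> cmp G (invs G g) g = ident G (src G g)"

definition orbit_space :: "('o, 'a) groupoid \<Rightarrow> 'o set set" where
  "orbit_space G =
     topspace (Obj G) // {(src G g, tgt G g) | g. g \<in> topspace (Arr G)}"

definition transitive_groupoid :: "('o, 'a) groupoid \<Rightarrow> bool" where
  "transitive_groupoid G \<longleftrightarrow> is_singleton (orbit_space G)"

definition source_fiber :: "('o, 'a) groupoid \<Rightarrow> 'o \<Rightarrow> 'a topology" where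
  "source_fiber G b = subtopology (Arr G) {g. src G g = b}"

definition target_fiber :: "('o, 'a) groupoid \<Rightarrow> 'o \<Rightarrow> 'a topology" where
  "target_fiber G b = subtopology (Arr G) {g. tgt G g = b}"

text \<open>The stabilizer group of \<open>b\<close>, viewed as a groupoid with the single object \<open>b\<close>.\<close>

definition stabilizer :: "('o, 'a) groupoid \<Rightarrow> 'o \<Rightarrow> ('o, 'a) groupoid" where
  "stabilizer G b =
     G\<lparr>Obj := subtopology (Obj G) {b},
       Arr := subtopology (Arr G) {g. src G g = b \<and> tgt G g = b}\<rparr>"


section \<open>Principal bundles\<close>

locale right_groupoid_space = topological_groupoid G
  for G :: "('o, 'a) groupoid" +
  fixes X :: "'x topology" and a :: "'x \<Rightarrow> 'o" and act :: "'x \<Rightarrow> 'a \<Rightarrow> 'x"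
  assumes cg_X: "cg_space X"
    and continuous_anchor: "continuous_map X (Obj G) a"
    and continuous_act:
      "continuous_map (subtopology (kprod X (Arr G)) {(x, g). a x = tgt G g}) X
         (\<lambda>(x, g). act x g)"
    and anchor_act:
      "\<lbrakk>x \<in> topspace X; g \<in> topspace (Arr G); a x = tgt G g\<rbrakk> \<Longrightarrow> a (act x g) = src G g"
    and act_ident: "x \<in> topspace X \<Longrightarrow> act x (ident G (a x)) = x"
    and act_act:
      "\<lbrakk>x \<in> topspace X; g \<in> topspace (Arr G); g' \<in> topspace (Arr G);
        a x = tgt G g; src G g = tgt G g'\<rbrakk>
        \<Longrightarrow> act (act x g) g' = act x (cmp G g g')"

record ('p, 'm, 'o, 'a) groupoid_bundle =
  total :: "'p topology"
  proj :: "'p \<Rightarrow> 'm"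
  anchor :: "'p \<Rightarrow> 'o"
  act :: "'p \<Rightarrow> 'a \<Rightarrow> 'p"

text \<open>
  Paracompactness of the total space is kept apart from the other conditions: it does not in general
  pass from a bundle of the stabilizer group to the induced bundle of the groupoid. For instance,
  if \<open>G\<close> is the pair groupoid of a space \<open>X\<close>, the principal
  \<open>G\<close>-bundle over a point has total space \<open>X\<close>, whereas the
  stabilizer group is trivial.
\<close>

locale principal_bundle_except_paracompact =
  right_groupoid_space G "total P" "anchor P" "act P"
  for G :: "('o, 'a) groupoid" and M :: "'m topology" and P :: "('p, 'm, 'o, 'a) groupoid_bundle" +
  assumes cg_base: "cg_space M"
    and paracompact_base: "paracompact_space M"
    and continuous_proj: "continuous_map (total P) M (proj P)"
    and surj_proj: "proj P ` topspace (total P) = topspace M"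
    and local_sections_proj: "admits_local_sections (total P) M (proj P)"
    and proj_act:
      "\<lbrakk>p \<in> topspace (total P); g \<in> topspace (Arr G); anchor P p = tgt G g\<rbrakk>
        \<Longrightarrow> proj P (act P p g) = proj P p"
    and homeomorphic_shear:
      "homeomorphic_map
         (subtopology (kprod (total P) (Arr G)) {(p, g). anchor P p = tgt G g})
         (subtopology (kprod (total P) (total P)) {(p, q). proj P p = proj P q})
         (\<lambda>(p, g). (p, act P p g))"

locale principal_bundle = principal_bundle_except_paracompact G M P
  for G :: "('o, 'a) groupoid" and M :: "'m topology" and P :: "('p, 'm, 'o, 'a) groupoid_bundle" +
  assumes paracompact_total: "paracompact_space (total P)"

definition bundle_isomorphism ::
  "('o, 'a) groupoid \<Rightarrow> ('p, 'm, 'o, 'a) groupoid_bundle \<Rightarrow> ('q, 'm, 'o, 'a) groupoid_bundle \<Rightarrow> ('p \<Rightarrow> 'q) \<Rightarrow> bool"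
where
  "bundle_isomorphism G P Q f \<longleftrightarrow>
     homeomorphic_map (total P) (total Q) f \<and>
     (\<forall>p\<in>topspace (total P). proj Q (f p) = proj P p \<and> anchor Q (f p) = anchor P p) \<and>
     (\<forall>p\<in>topspace (total P). \<forall>g\<in>topspace (Arr G).
        anchor P p = tgt G g \<longrightarrow> f (act P p g) = act Q (f p) g)"

definition bundle_isomorphic ::
  "('o, 'a) groupoid \<Rightarrow> ('p, 'm, 'o, 'a) groupoid_bundle \<Rightarrow> ('q, 'm, 'o, 'a) groupoid_bundle \<Rightarrow> bool" where
  "bundle_isomorphic G P Q \<longleftrightarrow> (\<exists>f. bundle_isomorphism G P Q f)"


section \<open>Restriction and extension\<close>

definition restrict_bundle :: "'o \<Rightarrow> ('p, 'm, 'o, 'a) groupoid_bundle \<Rightarrow> ('p, 'm, 'o, 'a) groupoid_bundle" where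
  "restrict_bundle b P = P\<lparr>total := subtopology (total P) {p. anchor P p = b}\<rparr>"

text \<open>
  The extension of a bundle \<open>Q\<close> of the stabilizer group at \<open>b\<close> is the
  balanced product of \<open>Q\<close> with the target fibre of \<open>b\<close>: the quotient by the
  relation \<open>(q h, g) \<sim> (q, h g)\<close>, with anchor \<open>[q, g] \<mapsto> src g\<close>
  and action \<open>[q, g] g' = [q, g g']\<close>.
\<close>

definition balanced_rel ::
  "('o, 'a) groupoid \<Rightarrow> 'o \<Rightarrow> ('q, 'm, 'o, 'a) groupoid_bundle \<Rightarrow> (('q \<times> 'a) \<times> ('q \<times> 'a)) set" where
  "balanced_rel G b Q =
     {((act Q q h, g), (q, cmp G h g)) | q h g.
        q \<in> topspace (total Q) \<and> h \<in> topspace (Arr (stabilizer G b)) \<and>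
        g \<in> topspace (target_fiber G b)}"

definition balanced_class ::
  "('o, 'a) groupoid \<Rightarrow> 'o \<Rightarrow> ('q, 'm, 'o, 'a) groupoid_bundle \<Rightarrow> 'q \<times> 'a \<Rightarrow> ('q \<times> 'a) set" where
  "balanced_class G b Q x = balanced_rel G b Q `` {x}"

text \<open>
  Projection and anchor are constant on each class, and the action permutes the classes, so
  \<open>the_elem\<close> and the image below give the induced maps on the quotient.
\<close>

definition extend_bundle ::
  "('o, 'a) groupoid \<Rightarrow> 'o \<Rightarrow> ('q, 'm, 'o, 'a) groupoid_bundle \<Rightarrow> (('q \<times> 'a) set, 'm, 'o, 'a) groupoid_bundle"
where
  "extend_bundle G b Q =
     \<lparr>total = quotient_topology (kprod (total Q) (target_fiber G b)) (balanced_class G b Q),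
      proj = (\<lambda>c. the_elem ((\<lambda>(q, g). proj Q q) ` c)),
      anchor = (\<lambda>c. the_elem ((\<lambda>(q, g). src G g) ` c)),
      act = (\<lambda>c g'. (\<lambda>(q, g). (q, cmp G g g')) ` c)\<rparr>"

end

theory Submission
  imports Defs
begin

text \<open>
  Over the domain of a local section \<open>\<sigma>\<close> of a principal bundle, a point of the total
  space is \<open>\<sigma> u\<close> acted on by a unique arrow, which depends continuously on the point
  (the division map, i.e. the inverse of the shear map). All continuity claims, as well as the
  Hausdorff property of the balanced product, are local over the base and are read off from such
  arrows; in particular an equivariant continuous map of principal bundles over the base is an
  isomorphism. Restriction and extension are then mutually inverse because
  \<open>[p, g] \<mapsto> p g\<close> and \<open>q \<mapsto> [q, 1]\<close> are such maps. Local sections of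
  \<open>tgt\<close> on the source fibre move a local section of a bundle into the anchor fibre.
\<close>

section \<open>Compactly generated spaces\<close>

text \<open>Componentwise continuity yields continuity into \<open>kprod\<close> when the domain is
  a k-space, and subspaces of k-spaces need not be k-spaces. This obstacle shapes the topology:
  domains are exhibited as closed subspaces (a fibre, or a fibre product over a Hausdorff space) or
  open subspaces (the part over an open set of the base) of compactly generated spaces. The target
  fibre serves in the extension because it carries two commuting actions: the stabilizer of
  \<open>b\<close> acts on the left and \<open>G\<close> on the right. Dividing out the first leaves
  the second. The quotient so obtained enters the domains of the action and of the division map only
  as a factor of a fibre product, where its universal property does not apply directly. It is
  applied instead to the projection, the anchor and the coordinate relative to a local section;
  action and division are then computed from these. Paracompactness of total spaces is settled
  separately, by passing to closed subspaces and along homeomorphisms.\<close>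

lemma topspace_kprod [simp]: "topspace (kprod X Y) = topspace X \<times> topspace Y"
  by (simp add: kprod_def)

lemma k_space_kprod: "k_space (kprod X Y)"
  by (simp add: kprod_def)

lemma continuous_map_fst_kprod: "continuous_map (kprod X Y) X fst"
  by (simp add: kprod_def continuous_map_from_kification continuous_map_fst)

lemma continuous_map_snd_kprod: "continuous_map (kprod X Y) Y snd"
  by (simp add: kprod_def continuous_map_from_kification continuous_map_snd)

lemma continuous_map_kprodI:
  "\<lbrakk>k_space Z; continuous_map Z X f; continuous_map Z Y g\<rbrakk>
    \<Longrightarrow> continuous_map Z (kprod X Y) (\<lambda>z. (f z, g z))"
  by (simp add: kprod_def continuous_map_into_kification continuous_map_pairedI)

text \<open>Kification only adds open sets, so disjoint open neighbourhoods stay available.\<close>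

lemma Hausdorff_space_kification: "Hausdorff_space X \<Longrightarrow> Hausdorff_space (kification X)"
  unfolding Hausdorff_space_def by (metis openin_kification_finer topspace_kification)

lemma cg_space_kprod: "\<lbrakk>cg_space X; cg_space Y\<rbrakk> \<Longrightarrow> cg_space (kprod X Y)"
  by (simp add: cg_space_def k_space_kprod)
    (simp add: kprod_def Hausdorff_space_kification Hausdorff_space_prod_topology)

lemma cg_space_closed_subtopology:
  "\<lbrakk>cg_space X; closedin X S\<rbrakk> \<Longrightarrow> cg_space (subtopology X S)"
  by (simp add: cg_space_def Hausdorff_space_subtopology k_space_closed_subtopology)

lemma cg_space_open_subtopology:
  "\<lbrakk>cg_space X; openin X S\<rbrakk> \<Longrightarrow> cg_space (subtopology X S)"
  by (simp add: cg_space_def Hausdorff_space_subtopology k_space_open_subtopology)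

lemma closedin_fibre:
  assumes "continuous_map X B f" "Hausdorff_space B"
  shows "closedin X (topspace X \<inter> {x. f x = b})"
proof (cases "b \<in> topspace B")
  case True
  then have "closedin B {b}"
    by (simp add: assms(2) closedin_Hausdorff_singleton)
  then show ?thesis
    using closedin_continuous_map_preimage[OF assms(1), of "{b}"] by (simp add: Int_def)
next
  case False
  then have "topspace X \<inter> {x. f x = b} = {}"
    using continuous_map_image_subset_topspace[OF assms(1)] by auto
  then show ?thesis
    by simp
qed

lemma cg_space_fibre:
  assumes "cg_space X" "continuous_map X B f" "Hausdorff_space B"
  shows "cg_space (subtopology X {x. f x = b})"
  using cg_space_closed_subtopology[OF assms(1) closedin_fibre[OF assms(2,3)]]
  by (simp only: subtopology_restrict)

text \<open>The locus where two maps into a Hausdorff space agree is closed. All fibre products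
  below are compactly generated for this reason.\<close>

lemma cg_space_equalizer:
  assumes "cg_space Z" "continuous_map Z B f" "continuous_map Z B g" "Hausdorff_space B"
  shows "cg_space (subtopology Z {z. f z = g z})"
proof -
  have "closedin Z (topspace Z \<inter> {z. f z = g z})"
    using closedin_continuous_maps_eq[OF assms(4,2,3)] by (simp add: Int_def)
  from cg_space_closed_subtopology[OF assms(1) this] show ?thesis
    by (simp only: subtopology_restrict)
qed

lemma cg_space_fibre_product:
  assumes "cg_space X" "cg_space Y" "continuous_map X B f" "continuous_map Y B g"
    "Hausdorff_space B"
  shows "cg_space (subtopology (kprod X Y) {(x, y). f x = g y})"
proof -
  have "cg_space (subtopology (kprod X Y) {z. (f \<circ> fst) z = (g \<circ> snd) z})"
    using assms
    by (intro cg_space_equalizer[where B=B] cg_space_kprod continuous_map_compose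
        [OF continuous_map_fst_kprod] continuous_map_compose[OF continuous_map_snd_kprod])
  moreover have "{z. (f \<circ> fst) z = (g \<circ> snd) z} = {(x, y). f x = g y}"
    by auto
  ultimately show ?thesis
    by simp
qed

text \<open>Turns a structure map on a fibre product (composition, action, division) into a rule for
  continuous families of arguments over an arbitrary k-space \<open>W\<close>. The last premise is
  where composability of the arguments gets checked.\<close>

lemma continuous_map_kprod_compose:
  assumes "continuous_map (subtopology (kprod X Y) S) Z (\<lambda>(x, y). h x y)"
    and "k_space W" "continuous_map W X f" "continuous_map W Y g"
    and "\<And>w. w \<in> topspace W \<Longrightarrow> (f w, g w) \<in> S"
  shows "continuous_map W Z (\<lambda>w. h (f w) (g w))"
proof -
  have "continuous_map W (subtopology (kprod X Y) S) (\<lambda>w. (f w, g w))"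
    using assms by (auto intro!: continuous_map_into_subtopology continuous_map_kprodI)
  from continuous_map_compose[OF this assms(1)] show ?thesis
    by (simp add: o_def)
qed

lemma continuous_map_fst_subtopology_kprod:
  "continuous_map (subtopology (kprod X Y) S) X fst"
  by (simp add: continuous_map_from_subtopology continuous_map_fst_kprod)

lemma continuous_map_snd_subtopology_kprod:
  "continuous_map (subtopology (kprod X Y) S) Y snd"
  by (simp add: continuous_map_from_subtopology continuous_map_snd_kprod)

text \<open>Pasting with one global map as every piece, so that agreement on overlaps is
  automatic.\<close>

lemma continuous_map_locallyI:
  assumes "\<And>x. x \<in> topspace X \<Longrightarrow>
      \<exists>U. openin X U \<and> x \<in> U \<and> continuous_map (subtopology X U) Y f"
  shows "continuous_map X Y f"
  by (rule pasting_lemma[where T="\<lambda>U. U" and f="\<lambda>_. f"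
        and I="{U. openin X U \<and> continuous_map (subtopology X U) Y f}"])
    (use assms in auto)

text \<open>Preimages that are open in the open set \<open>W\<close> are open in \<open>X\<close>,
  so a function defined only near the two points suffices to separate them. This fits coordinates,
  which are controlled only over the domain of a section.\<close>

lemma separated_by_continuous_map:
  assumes W: "openin X W" "x \<in> W" "y \<in> W"
    and f: "continuous_map (subtopology X W) Y f" "f x \<noteq> f y" and Y: "Hausdorff_space Y"
  shows "\<exists>U V. openin X U \<and> openin X V \<and> x \<in> U \<and> y \<in> V \<and> disjnt U V"
proof -
  have xy: "x \<in> topspace X" "y \<in> topspace X"
    using W openin_subset by blast+
  then have "f x \<in> topspace Y" "f y \<in> topspace Y"
    using continuous_map_image_subset_topspace[OF f(1)] W by auto
  then obtain U V where UV: "openin Y U" "openin Y V" "f x \<in> U" "f y \<in> V" "disjnt U V"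
    using Y f(2) unfolding Hausdorff_space_def by blast
  define pre where "pre S = {w \<in> topspace (subtopology X W). f w \<in> S}" for S
  have "openin X (pre S)" if "openin Y S" for S
    unfolding pre_def
    by (rule openin_trans_full[OF openin_continuous_map_preimage[OF f(1) that] W(1)])
  moreover have "x \<in> pre U" "y \<in> pre V" "disjnt (pre U) (pre V)"
    using UV W xy by (auto simp: disjnt_iff pre_def)
  ultimately show "\<exists>U V. openin X U \<and> openin X V \<and> x \<in> U \<and> y \<in> V \<and> disjnt U V"
    using UV(1,2) by metis
qed

section \<open>Paracompactness of closed subspaces and of homeomorphic images\<close>

lemma locally_finite_inE:
  assumes "locally_finite_in X \<V>" "x \<in> topspace X"
  obtains W where "openin X W" "x \<in> W" "finite {V \<in> \<V>. V \<inter> W \<noteq> {}}"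
  using assms unfolding locally_finite_in_def by blast

lemma paracompact_spaceE:
  assumes "paracompact_space X" "\<And>U. U \<in> \<U> \<Longrightarrow> openin X U" "\<Union>\<U> = topspace X"
  obtains \<V> where "\<forall>V\<in>\<V>. openin X V \<and> (\<exists>U\<in>\<U>. V \<subseteq> U)"
    "\<Union>\<V> = topspace X" "locally_finite_in X \<V>"
proof -
  have "(\<forall>U\<in>\<U>. openin X U) \<and> \<Union>\<U> = topspace X"
    using assms(2,3) by blast
  from mp[OF spec[OF assms(1)[unfolded paracompact_space_def]] this] show ?thesis
    using that by (elim exE conjE)
qed

text \<open>Extend the members of the cover to open sets of \<open>X\<close>, add the complement of
  \<open>C\<close>, refine in \<open>X\<close>, and take traces on \<open>C\<close>.\<close>

lemma paracompact_space_closed_subtopology: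
  assumes "paracompact_space X" "closedin X C"
  shows "paracompact_space (subtopology X C)"
  unfolding paracompact_space_def
proof (intro allI impI, elim conjE)
  fix \<U> assume op: "\<forall>U\<in>\<U>. openin (subtopology X C) U" and cov: "\<Union>\<U> = topspace (subtopology X C)"
  have CX: "C \<subseteq> topspace X"
    using assms(2) closedin_subset by blast
  have "\<forall>U\<in>\<U>. \<exists>T. openin X T \<and> U = T \<inter> C"
    using op by (simp add: openin_subtopology)
  then obtain T where T: "\<And>U. U \<in> \<U> \<Longrightarrow> openin X (T U)" "\<And>U. U \<in> \<U> \<Longrightarrow> U = T U \<inter> C"
    by metis
  let ?\<W> = "insert (topspace X - C) (T ` \<U>)"
  have "\<And>W. W \<in> ?\<W> \<Longrightarrow> openin X W"
    using T(1) assms(2) by auto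
  moreover have "\<Union>?\<W> = topspace X"
  proof
    show "\<Union>?\<W> \<subseteq> topspace X"
      using T(1) openin_subset by auto
    show "topspace X \<subseteq> \<Union>?\<W>"
    proof
      fix x assume x: "x \<in> topspace X"
      show "x \<in> \<Union>?\<W>"
      proof (cases "x \<in> C")
        case True
        then obtain U where "U \<in> \<U>" "x \<in> U"
          using cov x by auto
        then show ?thesis
          using T(2) by blast
      qed (use x in auto)
    qed
  qed
  ultimately obtain \<V> where V: "\<forall>V\<in>\<V>. openin X V \<and> (\<exists>U\<in>?\<W>. V \<subseteq> U)"
      "\<Union>\<V> = topspace X" "locally_finite_in X \<V>"
    by (rule paracompact_spaceE[OF assms(1), of ?\<W>])
  \<comment> \<open>A refining set inside the complement of \<open>C\<close> has empty trace. Empty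
    traces are discarded because such a set gives no member of \<open>\<U>\<close> to contain them,
    and \<open>\<U>\<close> may itself be empty.\<close>
  define \<V>' where "\<V>' = (\<lambda>V. V \<inter> C) ` \<V> - {{}}"
  have "locally_finite_in X \<V>'"
    unfolding \<V>'_def
    by (rule locally_finite_in_subset[OF locally_finite_in_refinement[OF V(3), of "\<lambda>V. V \<inter> C"]]) auto
  then have "locally_finite_in (subtopology X C) \<V>'"
    by (rule locally_finite_in_subtopology) (auto simp: \<V>'_def)
  moreover have "\<Union>\<V>' = \<Union>\<V> \<inter> C"
    unfolding \<V>'_def by blast
  then have "\<Union>\<V>' = topspace (subtopology X C)"
    using V(2) by simp
  moreover have "openin (subtopology X C) S \<and> (\<exists>U\<in>\<U>. S \<subseteq> U)" if S: "S \<in> \<V>'" for S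
  proof -
    have "S \<in> (\<lambda>V. V \<inter> C) ` \<V>" and ne: "S \<noteq> {}"
      using S by (simp_all add: \<V>'_def)
    then obtain V where VS: "V \<in> \<V>" "S = V \<inter> C"
      by (elim imageE)
    obtain W where W: "W \<in> ?\<W>" "V \<subseteq> W"
      using bspec[OF V(1) VS(1)] by (elim conjE bexE)
    have "W \<noteq> topspace X - C"
      using W(2) VS(2) ne by auto
    then obtain U where U: "U \<in> \<U>" "V \<subseteq> T U"
      using W by auto
    then have "S \<subseteq> U"
      using T(2)[OF U(1)] VS(2) by auto
    then show ?thesis
      using V(1) VS U(1) by (auto simp: openin_subtopology)
  qed
  ultimately show "\<exists>\<V>. (\<forall>V\<in>\<V>. openin (subtopology X C) V \<and> (\<exists>U\<in>\<U>. V \<subseteq> U)) \<and>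
      \<Union>\<V> = topspace (subtopology X C) \<and> locally_finite_in (subtopology X C) \<V>"
    by (intro exI[of _ "\<V>'"]) simp
qed

text \<open>Refine the pulled-back cover and push the refinement forward.\<close>

lemma homeomorphic_map_paracompact_space:
  assumes "homeomorphic_map X Y f" "paracompact_space X"
  shows "paracompact_space Y"
  unfolding paracompact_space_def
proof (intro allI impI, elim conjE)
  fix \<U> assume op: "\<forall>U\<in>\<U>. openin Y U" and cov: "\<Union>\<U> = topspace Y"
  obtain g where fg: "continuous_map X Y f" "continuous_map Y X g"
      "\<And>x. x \<in> topspace X \<Longrightarrow> g (f x) = x" "\<And>y. y \<in> topspace Y \<Longrightarrow> f (g y) = y"
    using assms(1) by (auto simp: homeomorphic_map_maps homeomorphic_maps_def)
  have fX: "f x \<in> topspace Y" if "x \<in> topspace X" for x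
    using fg(1) that by (auto simp: continuous_map_def)
  have gY: "g y \<in> topspace X" if "y \<in> topspace Y" for y
    using fg(2) that by (auto simp: continuous_map_def)
  define pre where "pre U = {x \<in> topspace X. f x \<in> U}" for U
  have "\<And>W. W \<in> pre ` \<U> \<Longrightarrow> openin X W"
    using op openin_continuous_map_preimage[OF fg(1)] by (auto simp: pre_def)
  moreover have "\<Union>(pre ` \<U>) = topspace X"
    using cov fX by (auto simp: pre_def)
  ultimately obtain \<V> where V: "\<forall>V\<in>\<V>. openin X V \<and> (\<exists>U\<in>pre ` \<U>. V \<subseteq> U)"
      "\<Union>\<V> = topspace X" "locally_finite_in X \<V>"
    by (rule paracompact_spaceE[OF assms(2), of "pre ` \<U>"])
  have VX: "V \<subseteq> topspace X" if "V \<in> \<V>" for V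
    using V(2) that by blast
  have opf: "openin Y (f ` W)" if "openin X W" for W
    using that homeomorphic_map_openness[OF assms(1) openin_subset[OF that]] by blast
  have "locally_finite_in Y ((`) f ` \<V>)"
    unfolding locally_finite_in_def
  proof (intro conjI ballI)
    show "\<Union>((`) f ` \<V>) \<subseteq> topspace Y"
      using VX fX by blast
    fix y assume y: "y \<in> topspace Y"
    obtain W where W: "openin X W" "g y \<in> W" "finite {U \<in> \<V>. U \<inter> W \<noteq> {}}"
      by (rule locally_finite_inE[OF V(3) gY[OF y]])
    \<comment> \<open>Injectivity of \<open>f\<close> enters here: images can meet only if the sets
      do, so local finiteness survives the push-forward.\<close>
    have meet: "V \<inter> W \<noteq> {}" if V: "V \<in> \<V>" "f ` V \<inter> f ` W \<noteq> {}" for V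
    proof -
      obtain v w where "v \<in> V" "w \<in> W" "f v = f w"
        using V(2) by blast
      moreover have "v \<in> topspace X" "w \<in> topspace X"
        using calculation VX[OF V(1)] openin_subset[OF W(1)] by (simp_all add: subsetD)
      ultimately have "v = w"
        by (metis fg(3))
      with \<open>v \<in> V\<close> \<open>w \<in> W\<close> show ?thesis
        by blast
    qed
    have "{U \<in> (`) f ` \<V>. U \<inter> f ` W \<noteq> {}} \<subseteq> (`) f ` {U \<in> \<V>. U \<inter> W \<noteq> {}}"
      by (intro subsetI) (elim CollectE conjE imageE, simp add: meet)
    then have "finite {U \<in> (`) f ` \<V>. U \<inter> f ` W \<noteq> {}}"
      by (rule finite_subset) (intro finite_imageI W(3))
    moreover have "y \<in> f ` W"
      using fg(4)[OF y] W(2) by (metis imageI)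
    ultimately show "\<exists>V. openin Y V \<and> y \<in> V \<and> finite {U \<in> (`) f ` \<V>. U \<inter> V \<noteq> {}}"
      using opf[OF W(1)] by (intro exI[of _ "f ` W"] conjI)
  qed
  moreover have "\<Union>((`) f ` \<V>) = topspace Y"
  proof -
    have "\<Union>((`) f ` \<V>) = f ` topspace X"
      unfolding V(2)[symmetric] by blast
    also have "\<dots> = topspace Y"
      using assms(1) homeomorphic_imp_surjective_map by blast
    finally show ?thesis .
  qed
  moreover have "openin Y (f ` S) \<and> (\<exists>U\<in>\<U>. f ` S \<subseteq> U)" if S: "S \<in> \<V>" for S
  proof -
    obtain U where "U \<in> \<U>" "S \<subseteq> pre U"
      using V(1) S by blast
    then have "f ` S \<subseteq> U"
      by (auto simp: pre_def)
    then show ?thesis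
      using V(1) S opf \<open>U \<in> \<U>\<close> by blast
  qed
  ultimately show "\<exists>\<V>. (\<forall>V\<in>\<V>. openin Y V \<and> (\<exists>U\<in>\<U>. V \<subseteq> U)) \<and>
      \<Union>\<V> = topspace Y \<and> locally_finite_in Y \<V>"
    by (intro exI[of _ "(`) f ` \<V>"]) simp
qed

section \<open>Groupoids and stabilizers\<close>

context topological_groupoid
begin

section \<open>Membership and cancellation rules for arrows\<close>

lemma Hausdorff_Obj: "Hausdorff_space (Obj G)"
  using cg_Obj by (simp add: cg_space_def)

lemma ident_in [simp]: "x \<in> topspace (Obj G) \<Longrightarrow> ident G x \<in> topspace (Arr G)"
  using continuous_ident by (auto simp: continuous_map_def)

lemma src_in [simp]: "g \<in> topspace (Arr G) \<Longrightarrow> src G g \<in> topspace (Obj G)"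
  using continuous_src by (auto simp: continuous_map_def)

lemma tgt_in [simp]: "g \<in> topspace (Arr G) \<Longrightarrow> tgt G g \<in> topspace (Obj G)"
  using continuous_tgt by (auto simp: continuous_map_def)

lemma invs_in [simp]: "g \<in> topspace (Arr G) \<Longrightarrow> invs G g \<in> topspace (Arr G)"
  using continuous_invs by (auto simp: continuous_map_def)

lemma cmp_in [simp]:
  "\<lbrakk>g \<in> topspace (Arr G); h \<in> topspace (Arr G); src G g = tgt G h\<rbrakk>
    \<Longrightarrow> cmp G g h \<in> topspace (Arr G)"
  using continuous_map_image_subset_topspace[OF continuous_cmp] by force

declare src_ident [simp] tgt_ident [simp] src_cmp [simp] tgt_cmp [simp] src_invs [simp]
  tgt_invs [simp] cmp_ident_right [simp] cmp_ident_left [simp] cmp_invs_right [simp]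
  cmp_invs_left [simp]

lemma cmp_invs_cmp [simp]:
  "\<lbrakk>g \<in> topspace (Arr G); h \<in> topspace (Arr G); src G g = tgt G h\<rbrakk>
    \<Longrightarrow> cmp G (invs G g) (cmp G g h) = h"
  by (simp add: cmp_assoc[symmetric])

lemma cmp_cmp_invs [simp]:
  "\<lbrakk>g \<in> topspace (Arr G); h \<in> topspace (Arr G); tgt G g = tgt G h\<rbrakk>
    \<Longrightarrow> cmp G g (cmp G (invs G g) h) = h"
  by (simp add: cmp_assoc[symmetric])

lemma cmp_left_cancel:
  "\<lbrakk>cmp G g h = cmp G g k; g \<in> topspace (Arr G); h \<in> topspace (Arr G); k \<in> topspace (Arr G);
    src G g = tgt G h; src G g = tgt G k\<rbrakk> \<Longrightarrow> h = k"
  by (metis cmp_invs_cmp)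

lemma continuous_map_cmp:
  assumes "cg_space W" "continuous_map W (Arr G) f" "continuous_map W (Arr G) g"
    and "\<And>w. w \<in> topspace W \<Longrightarrow> src G (f w) = tgt G (g w)"
  shows "continuous_map W (Arr G) (\<lambda>w. cmp G (f w) (g w))"
  by (rule continuous_map_kprod_compose[OF continuous_cmp])
    (use assms in \<open>auto simp: cg_space_def\<close>)

lemma continuous_map_invs:
  "continuous_map W (Arr G) f \<Longrightarrow> continuous_map W (Arr G) (\<lambda>w. invs G (f w))"
  using continuous_map_compose[OF _ continuous_invs] by (simp add: o_def)

text \<open>The members of the orbit space are the sets of targets of arrows leaving a given object.
  If there is only one such set, then \<open>y\<close>, which is reached from itself by its
  identity, is also reached from \<open>x\<close>.\<close>

lemma transitiveE:
  assumes "transitive_groupoid G" "x \<in> topspace (Obj G)" "y \<in> topspace (Obj G)"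
  obtains g where "g \<in> topspace (Arr G)" "src G g = x" "tgt G g = y"
proof -
  define R where "R = {(src G g, tgt G g) | g. g \<in> topspace (Arr G)}"
  obtain C where C: "orbit_space G = {C}"
    using assms(1) unfolding transitive_groupoid_def by (rule is_singletonE)
  have RC: "R `` {z} = C" if "z \<in> topspace (Obj G)" for z
    using quotientI[OF that, of R] C by (simp add: orbit_space_def R_def)
  have "(y, y) \<in> R"
    using assms(3) src_ident tgt_ident ident_in unfolding R_def
    by (intro CollectI exI[of _ "ident G y"]) simp
  then have "(x, y) \<in> R"
    using RC[OF assms(2)] RC[OF assms(3)] by blast
  then show ?thesis
    using that unfolding R_def by blast
qed

section \<open>The stabilizer group as a topological groupoid\<close>

lemma topspace_Arr_stabilizer:
  "topspace (Arr (stabilizer G b)) = {g \<in> topspace (Arr G). src G g = b \<and> tgt G g = b}"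
  by (auto simp: stabilizer_def)

lemma stabilizer_simps [simp]:
  "ident (stabilizer G b) = ident G" "src (stabilizer G b) = src G" "tgt (stabilizer G b) = tgt G"
  "invs (stabilizer G b) = invs G" "cmp (stabilizer G b) = cmp G"
  "Obj (stabilizer G b) = subtopology (Obj G) {b}"
  by (simp_all add: stabilizer_def)

lemma Arr_stabilizer:
  "Arr (stabilizer G b) = subtopology (Arr G) {g. src G g = b \<and> tgt G g = b}"
  by (simp add: stabilizer_def)

lemma cg_space_Arr_stabilizer: "cg_space (Arr (stabilizer G b))"
proof -
  have "cg_space (subtopology (subtopology (Arr G) {g. src G g = b}) {g. tgt G g = b})"
    by (intro cg_space_fibre[where B="Obj G"] cg_Arr continuous_src Hausdorff_Obj
        continuous_map_from_subtopology continuous_tgt)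
  then show ?thesis
    by (simp add: Arr_stabilizer subtopology_subtopology Collect_conj_eq)
qed

lemma continuous_map_Arr_stabilizer:
  "continuous_map W (Arr (stabilizer G b)) f \<longleftrightarrow>
    continuous_map W (Arr G) f \<and> (\<forall>w\<in>topspace W. src G (f w) = b \<and> tgt G (f w) = b)"
  by (auto simp: Arr_stabilizer continuous_map_in_subtopology)

lemma continuous_map_Arr_stabilizerD:
  "continuous_map W (Arr (stabilizer G b)) f \<Longrightarrow> continuous_map W (Arr G) f"
  by (simp add: continuous_map_Arr_stabilizer)

lemma topological_groupoid_stabilizer:
  assumes "b \<in> topspace (Obj G)"
  shows "topological_groupoid (stabilizer G b)"
proof
  show "cg_space (Obj (stabilizer G b))"
    using assms by (auto intro!: cg_space_closed_subtopology cg_Obj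
        closedin_Hausdorff_singleton Hausdorff_Obj)
  show "cg_space (Arr (stabilizer G b))"
    by (rule cg_space_Arr_stabilizer)
  show "continuous_map (Obj (stabilizer G b)) (Arr (stabilizer G b)) (ident (stabilizer G b))"
    using assms by (auto simp: continuous_map_Arr_stabilizer continuous_ident
        intro: continuous_map_from_subtopology)
  show "continuous_map (Arr (stabilizer G b)) (Obj (stabilizer G b)) (src (stabilizer G b))"
    by (auto simp: Arr_stabilizer continuous_src continuous_map_in_subtopology
        intro: continuous_map_from_subtopology)
  show "continuous_map (Arr (stabilizer G b)) (Obj (stabilizer G b)) (tgt (stabilizer G b))"
    by (auto simp: Arr_stabilizer continuous_tgt continuous_map_in_subtopology
        intro: continuous_map_from_subtopology)
  show "continuous_map (Arr (stabilizer G b)) (Arr (stabilizer G b)) (invs (stabilizer G b))"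
    by (auto simp: Arr_stabilizer continuous_invs continuous_map_in_subtopology
        intro: continuous_map_from_subtopology)
  \<comment> \<open>The product of the stabilizer with itself is kified on its own, not taken as a
    subspace of the product for \<open>G\<close>. Continuity of composition is therefore obtained
    from the two projections, regarded as families of arrows of \<open>G\<close> over a compactly
    generated domain.\<close>
  let ?D = "subtopology (kprod (Arr (stabilizer G b)) (Arr (stabilizer G b)))
      {(g, h). src (stabilizer G b) g = tgt (stabilizer G b) h}"
  have "cg_space ?D"
    using continuous_map_from_subtopology[OF continuous_src]
      continuous_map_from_subtopology[OF continuous_tgt] cg_space_Arr_stabilizer Hausdorff_Obj
    by (intro cg_space_fibre_product[where B="Obj G"]) (auto simp: Arr_stabilizer)
  moreover have "continuous_map ?D (Arr G) fst" "continuous_map ?D (Arr G) snd"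
    by (rule continuous_map_Arr_stabilizerD, rule continuous_map_fst_subtopology_kprod
        continuous_map_snd_subtopology_kprod)+
  ultimately have "continuous_map ?D (Arr G) (\<lambda>x. cmp G (fst x) (snd x))"
    by (rule continuous_map_cmp) auto
  then show "continuous_map ?D (Arr (stabilizer G b)) (\<lambda>(g, h). cmp (stabilizer G b) g h)"
    by (auto simp: continuous_map_Arr_stabilizer topspace_Arr_stabilizer case_prod_unfold)
  show "open_map (Arr (stabilizer G b)) (Obj (stabilizer G b)) (src (stabilizer G b))"
    unfolding open_map_def
  proof (intro allI impI)
    fix U assume "openin (Arr (stabilizer G b)) U"
    then have "U \<subseteq> {g. src G g = b}"
      by (force dest: openin_subset simp: topspace_Arr_stabilizer)
    \<comment> \<open>With a single object the image of a set of arrows is empty or everything,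
      which gives openness at once.\<close>
    then have "src G ` U = {} \<or> src G ` U = topspace (Obj (stabilizer G b))"
      using assms by auto
    then show "openin (Obj (stabilizer G b)) (src (stabilizer G b) ` U)"
      by (metis openin_empty openin_topspace stabilizer_simps(2))
  qed
qed (auto simp: topspace_Arr_stabilizer intro: cmp_assoc, metis cmp_ident_left)

end

section \<open>The division map of a principal bundle\<close>

text \<open>The fibre product is closed in \<open>kprod X X\<close>, and its part over
  \<open>W\<close> is open in it. These spaces are the domains of the local division maps.\<close>

lemma cg_space_fibre_product_open:
  assumes "cg_space X" "continuous_map X M f" "Hausdorff_space M" "openin M W"
  shows "cg_space (subtopology (kprod X X) {(x, y). f x = f y \<and> f x \<in> W})"
proof -
  let ?B = "subtopology (kprod X X) {(x, y). f x = f y}"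
  have "continuous_map ?B M (\<lambda>z. f (fst z))"
    using continuous_map_compose[OF continuous_map_fst_subtopology_kprod assms(2)]
    by (simp add: o_def)
  then have "openin ?B {z \<in> topspace ?B. f (fst z) \<in> W}"
    using assms(4) by (rule openin_continuous_map_preimage)
  moreover have "cg_space ?B"
    using assms by (intro cg_space_fibre_product[where B=M])
  ultimately have "cg_space (subtopology ?B {z \<in> topspace ?B. f (fst z) \<in> W})"
    by (simp only: cg_space_open_subtopology)
  moreover have "subtopology ?B {z \<in> topspace ?B. f (fst z) \<in> W} =
      subtopology (kprod X X) (topspace (kprod X X) \<inter> {(x, y). f x = f y \<and> f x \<in> W})"
    unfolding subtopology_subtopology by (rule arg_cong[where f="subtopology (kprod X X)"]) auto
  ultimately show ?thesis
    by (simp only: subtopology_restrict)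
qed

context right_groupoid_space
begin

lemma anchor_in [simp]: "x \<in> topspace X \<Longrightarrow> a x \<in> topspace (Obj G)"
  using continuous_anchor by (auto simp: continuous_map_def)

lemma act_in [simp]:
  "\<lbrakk>x \<in> topspace X; g \<in> topspace (Arr G); a x = tgt G g\<rbrakk> \<Longrightarrow> act x g \<in> topspace X"
  using continuous_map_image_subset_topspace[OF continuous_act] by force

declare anchor_act [simp]

lemma continuous_map_act:
  assumes "cg_space W" "continuous_map W X f" "continuous_map W (Arr G) g"
    and "\<And>w. w \<in> topspace W \<Longrightarrow> a (f w) = tgt G (g w)"
  shows "continuous_map W X (\<lambda>w. act (f w) (g w))"
  by (rule continuous_map_kprod_compose[OF continuous_act])
    (use assms in \<open>auto simp: cg_space_def\<close>)

text \<open>Depends on the action alone, so that the candidate inverse of a shear map can be named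
  before the shear map is known to be invertible. The value is determined only where exactly one
  such arrow exists.\<close>

definition division where
  "division x y = (THE g. g \<in> topspace (Arr G) \<and> a x = tgt G g \<and> act x g = y)"

text \<open>Freeness makes the arrow from \<open>x\<close> to \<open>y\<close> unique, so continuous
  local choices \<open>d\<close> agree with one another and patch to a continuous inverse of the
  shear map. The criterion serves both constructions: restriction with a single global
  \<open>d\<close>, extension with one \<open>d\<close> for each local section.\<close>

lemma homeomorphic_shearI:
  assumes cont: "continuous_map X M \<pi>" and M: "Hausdorff_space M"
    and \<pi>_act: "\<And>x g. \<lbrakk>x \<in> topspace X; g \<in> topspace (Arr G); a x = tgt G g\<rbrakk> \<Longrightarrow> \<pi> (act x g) = \<pi> x"
    and free: "\<And>x g g'. \<lbrakk>x \<in> topspace X; g \<in> topspace (Arr G); g' \<in> topspace (Arr G);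
        a x = tgt G g; a x = tgt G g'; act x g = act x g'\<rbrakk> \<Longrightarrow> g = g'"
    and loc: "\<And>m. m \<in> topspace M \<Longrightarrow> \<exists>W d. openin M W \<and> m \<in> W \<and>
        continuous_map (subtopology (kprod X X) {(x, y). \<pi> x = \<pi> y \<and> \<pi> x \<in> W}) (Arr G)
          (\<lambda>z. d (fst z) (snd z)) \<and>
        (\<forall>x\<in>topspace X. \<forall>y\<in>topspace X. \<pi> x = \<pi> y \<and> \<pi> x \<in> W \<longrightarrow>
          a x = tgt G (d x y) \<and> act x (d x y) = y)"
  shows "homeomorphic_map (subtopology (kprod X (Arr G)) {(x, g). a x = tgt G g})
     (subtopology (kprod X X) {(x, y). \<pi> x = \<pi> y}) (\<lambda>(x, g). (x, act x g))"
proof -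
  let ?A = "subtopology (kprod X (Arr G)) {(x, g). a x = tgt G g}"
  let ?B = "subtopology (kprod X X) {(x, y). \<pi> x = \<pi> y}"
  have division_eq: "division x y = g"
    if "x \<in> topspace X" "g \<in> topspace (Arr G)" "a x = tgt G g" "act x g = y" for x y g
    unfolding division_def by (rule the_equality) (use that free in auto)
  \<comment> \<open>Continuity of \<open>d\<close> places its values among the arrows; freeness then
    identifies each local \<open>d\<close> with the global \<open>division\<close>.\<close>
  have loc': "\<exists>W d. openin M W \<and> m \<in> W \<and>
        continuous_map (subtopology (kprod X X) {(x, y). \<pi> x = \<pi> y \<and> \<pi> x \<in> W}) (Arr G)
          (\<lambda>z. d (fst z) (snd z)) \<and>
        (\<forall>x\<in>topspace X. \<forall>y\<in>topspace X. \<pi> x = \<pi> y \<and> \<pi> x \<in> W \<longrightarrow>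
          d x y \<in> topspace (Arr G) \<and> a x = tgt G (d x y) \<and> act x (d x y) = y \<and>
          division x y = d x y)" if m: "m \<in> topspace M" for m
  proof -
    obtain W d where W: "openin M W" "m \<in> W"
      and d: "continuous_map (subtopology (kprod X X) {(x, y). \<pi> x = \<pi> y \<and> \<pi> x \<in> W}) (Arr G)
          (\<lambda>z. d (fst z) (snd z))"
      and dW: "\<And>x y. \<lbrakk>x \<in> topspace X; y \<in> topspace X; \<pi> x = \<pi> y; \<pi> x \<in> W\<rbrakk> \<Longrightarrow>
          a x = tgt G (d x y) \<and> act x (d x y) = y"
      using loc[OF m] by blast
    have "d x y \<in> topspace (Arr G) \<and> a x = tgt G (d x y) \<and> act x (d x y) = y \<and>
          division x y = d x y"
      if xy: "x \<in> topspace X" "y \<in> topspace X" "\<pi> x = \<pi> y" "\<pi> x \<in> W" for x y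
    proof -
      have "d x y \<in> topspace (Arr G)"
        using continuous_map_image_subset_topspace[OF d] xy by force
      with dW[OF xy] show ?thesis
        using division_eq[of x "d x y" y] xy(1) by simp
    qed
    then have "\<forall>x\<in>topspace X. \<forall>y\<in>topspace X. \<pi> x = \<pi> y \<and> \<pi> x \<in> W \<longrightarrow>
          d x y \<in> topspace (Arr G) \<and> a x = tgt G (d x y) \<and> act x (d x y) = y \<and>
          division x y = d x y"
      by blast
    with W d show ?thesis
      by (intro exI[of _ W] exI[of _ d] conjI)
  qed
  have div: "division x y \<in> topspace (Arr G)" "tgt G (division x y) = a x"
      "act x (division x y) = y"
    if xy: "x \<in> topspace X" "y \<in> topspace X" "\<pi> x = \<pi> y" for x y
  proof -
    have "\<pi> x \<in> topspace M"
      using cont xy(1) by (auto simp: continuous_map_def)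
    from loc'[OF this] obtain W d where W: "openin M W" "\<pi> x \<in> W"
      and d: "continuous_map (subtopology (kprod X X) {(x, y). \<pi> x = \<pi> y \<and> \<pi> x \<in> W}) (Arr G)
          (\<lambda>z. d (fst z) (snd z))"
      and dW: "\<forall>x\<in>topspace X. \<forall>y\<in>topspace X. \<pi> x = \<pi> y \<and> \<pi> x \<in> W \<longrightarrow>
          d x y \<in> topspace (Arr G) \<and> a x = tgt G (d x y) \<and> act x (d x y) = y \<and>
          division x y = d x y"
      by (elim exE conjE)
    from bspec[OF bspec[OF dW xy(1)] xy(2)] xy(3) W(2)
    show "division x y \<in> topspace (Arr G)" "tgt G (division x y) = a x" "act x (division x y) = y"
      by simp_all
  qed
  have B: "cg_space ?B"
    by (intro cg_space_fibre_product[OF cg_X cg_X cont cont M])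
  have "continuous_map ?B (Arr G) (\<lambda>z. division (fst z) (snd z))"
  proof (rule continuous_map_locallyI)
    fix z assume z: "z \<in> topspace ?B"
    then have "\<pi> (fst z) \<in> topspace M"
      using cont by (auto simp: continuous_map_def)
    from loc'[OF this] obtain W d where W: "openin M W" "\<pi> (fst z) \<in> W"
      and d: "continuous_map (subtopology (kprod X X) {(x, y). \<pi> x = \<pi> y \<and> \<pi> x \<in> W}) (Arr G)
          (\<lambda>z. d (fst z) (snd z))"
      and dW: "\<forall>x\<in>topspace X. \<forall>y\<in>topspace X. \<pi> x = \<pi> y \<and> \<pi> x \<in> W \<longrightarrow>
          d x y \<in> topspace (Arr G) \<and> a x = tgt G (d x y) \<and> act x (d x y) = y \<and>
          division x y = d x y"
      by (elim exE conjE)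
    define U where "U = {z \<in> topspace ?B. \<pi> (fst z) \<in> W}"
    have "continuous_map ?B M (\<lambda>z. \<pi> (fst z))"
      using continuous_map_compose[OF continuous_map_fst_subtopology_kprod cont]
      by (simp add: o_def)
    then have "openin ?B U"
      unfolding U_def using W(1) by (rule openin_continuous_map_preimage)
    moreover have "z \<in> U"
      using z W by (simp add: U_def)
    moreover have "continuous_map (subtopology ?B U) (Arr G) (\<lambda>z. division (fst z) (snd z))"
    proof (rule continuous_map_eq)
      show "continuous_map (subtopology ?B U) (Arr G) (\<lambda>z. d (fst z) (snd z))"
        unfolding subtopology_subtopology
        by (rule continuous_map_from_subtopology_mono[OF d]) (auto simp: U_def)
      show "d (fst w) (snd w) = division (fst w) (snd w)" if "w \<in> topspace (subtopology ?B U)" for w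
        using that dW by (auto simp: U_def)
    qed
    ultimately show "\<exists>U. openin ?B U \<and> z \<in> U \<and>
        continuous_map (subtopology ?B U) (Arr G) (\<lambda>z. division (fst z) (snd z))"
      by (intro exI[of _ U] conjI)
  qed
  then have "continuous_map ?B (kprod X (Arr G)) (\<lambda>z. (fst z, division (fst z) (snd z)))"
    using B by (intro continuous_map_kprodI continuous_map_fst_subtopology_kprod)
      (simp_all add: cg_space_def)
  then have "continuous_map ?B ?A (\<lambda>z. (fst z, division (fst z) (snd z)))"
    by (rule continuous_map_into_subtopology) (auto simp: div)
  moreover have "continuous_map ?A ?B (\<lambda>z. (fst z, act (fst z) (snd z)))"
  proof (rule continuous_map_into_subtopology)
    have A: "cg_space ?A"
      by (intro cg_space_fibre_product[OF cg_X cg_Arr continuous_anchor continuous_tgt Hausdorff_Obj])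
    have "continuous_map ?A X (\<lambda>z. act (fst z) (snd z))"
      by (rule continuous_map_act[OF A continuous_map_fst_subtopology_kprod
            continuous_map_snd_subtopology_kprod]) auto
    then show "continuous_map ?A (kprod X X) (\<lambda>z. (fst z, act (fst z) (snd z)))"
      using A by (intro continuous_map_kprodI continuous_map_fst_subtopology_kprod)
        (simp_all add: cg_space_def)
  qed (auto simp: \<pi>_act)
  ultimately have "homeomorphic_maps ?A ?B (\<lambda>z. (fst z, act (fst z) (snd z)))
      (\<lambda>z. (fst z, division (fst z) (snd z)))"
    unfolding homeomorphic_maps_def by (auto simp: div division_eq)
  then show ?thesis
    unfolding homeomorphic_map_maps by (auto simp: case_prod_unfold)
qed

end

context principal_bundle_except_paracompact
begin

lemma Hausdorff_base: "Hausdorff_space M"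
  using cg_base by (simp add: cg_space_def)

lemma proj_in [simp]: "p \<in> topspace (total P) \<Longrightarrow> proj P p \<in> topspace M"
  using continuous_proj by (auto simp: continuous_map_def)

declare proj_act [simp]

lemma act_left_cancel:
  assumes "act P p g = act P p g'" "p \<in> topspace (total P)" "g \<in> topspace (Arr G)"
    "g' \<in> topspace (Arr G)" "anchor P p = tgt G g" "anchor P p = tgt G g'"
  shows "g = g'"
proof -
  have "(p, g) = (p, g')"
    by (rule inj_onD[OF homeomorphic_imp_injective_map[OF homeomorphic_shear]])
      (use assms in auto)
  then show ?thesis
    by simp
qed

lemma division_act [simp]:
  assumes "p \<in> topspace (total P)" "g \<in> topspace (Arr G)" "anchor P p = tgt G g"
  shows "division p (act P p g) = g"
  unfolding division_def by (rule the_equality) (use assms act_left_cancel in auto)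

text \<open>Surjectivity of the shear map onto the fibre product supplies an arrow from
  \<open>p\<close> to \<open>q\<close>; by \<open>division_act\<close>, which rests on injectivity,
  this arrow is the division.\<close>

lemma division:
  assumes "p \<in> topspace (total P)" "q \<in> topspace (total P)" "proj P p = proj P q"
  shows division_in [simp]: "division p q \<in> topspace (Arr G)"
    and tgt_division [simp]: "tgt G (division p q) = anchor P p"
    and act_division [simp]: "act P p (division p q) = q"
    and src_division [simp]: "src G (division p q) = anchor P q"
proof -
  have "(p, q) \<in> topspace (subtopology (kprod (total P) (total P)) {(p, q). proj P p = proj P q})"
    using assms by simp
  then have "(p, q) \<in> (\<lambda>(p, g). (p, act P p g)) `
      topspace (subtopology (kprod (total P) (Arr G)) {(p, g). anchor P p = tgt G g})"
    by (simp only: homeomorphic_imp_surjective_map[OF homeomorphic_shear])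
  then obtain g where g: "g \<in> topspace (Arr G)" "anchor P p = tgt G g" "act P p g = q"
    by auto
  then have "division p q = g"
    using division_act[OF assms(1), of g] by simp
  with g assms show "division p q \<in> topspace (Arr G)" "tgt G (division p q) = anchor P p"
    "act P p (division p q) = q" "src G (division p q) = anchor P q"
    by auto
qed

lemma division_act_right:
  assumes "p \<in> topspace (total P)" "q \<in> topspace (total P)" "proj P p = proj P q"
    "g \<in> topspace (Arr G)" "anchor P q = tgt G g"
  shows "division p (act P q g) = cmp G (division p q) g"
proof -
  have "act P p (cmp G (division p q) g) = act P q g"
    using assms act_act[of p "division p q" g] by simp
  moreover have "division p (act P p (cmp G (division p q) g)) = cmp G (division p q) g"
    using assms by simp
  ultimately show ?thesis
    by simp
qed

text \<open>The inverse of the shear map is continuous by the bundle axioms, and its second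
  component is the division map.\<close>

lemma continuous_map_division:
  assumes "cg_space W" "continuous_map W (total P) f" "continuous_map W (total P) g"
    and fg: "\<And>w. w \<in> topspace W \<Longrightarrow> proj P (f w) = proj P (g w)"
  shows "continuous_map W (Arr G) (\<lambda>w. division (f w) (g w))"
proof -
  let ?A = "subtopology (kprod (total P) (Arr G)) {(p, g). anchor P p = tgt G g}"
  let ?B = "subtopology (kprod (total P) (total P)) {(p, q). proj P p = proj P q}"
  obtain k where k: "continuous_map ?B ?A k"
    and inv: "\<And>z. z \<in> topspace ?B \<Longrightarrow> (\<lambda>(p, g). (p, act P p g)) (k z) = z"
    using homeomorphic_shear unfolding homeomorphic_map_maps homeomorphic_maps_def by blast
  have kB: "snd (k z) = division (fst z) (snd z)" if z: "z \<in> topspace ?B" for z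
  proof -
    have "k z \<in> topspace ?A"
      using continuous_map_image_subset_topspace[OF k] z by (rule subsetD[OF _ imageI])
    then show ?thesis
      using inv[OF z] by (auto simp: case_prod_unfold)
  qed
  have "continuous_map ?B (Arr G) (\<lambda>z. snd (k z))"
    using continuous_map_compose[OF k continuous_map_snd_subtopology_kprod] by (simp add: o_def)
  then have "continuous_map ?B (Arr G) (\<lambda>(p, q). division p q)"
    by (rule continuous_map_eq) (auto simp: kB)
  then show ?thesis
    by (rule continuous_map_kprod_compose) (use assms in \<open>auto simp: cg_space_def\<close>)
qed

section \<open>Local sections, together with membership of their values in the total space\<close>

definition local_section where
  "local_section U \<sigma> \<longleftrightarrow> openin M U \<and> continuous_map (subtopology M U) (total P) \<sigma> \<and>
    (\<forall>u\<in>U. \<sigma> u \<in> topspace (total P) \<and> proj P (\<sigma> u) = u)"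

lemma local_sectionD:
  assumes "local_section U \<sigma>"
  shows "openin M U" "continuous_map (subtopology M U) (total P) \<sigma>"
    "u \<in> U \<Longrightarrow> \<sigma> u \<in> topspace (total P)" "u \<in> U \<Longrightarrow> proj P (\<sigma> u) = u"
  using assms by (simp_all add: local_section_def)

lemma local_sectionE:
  assumes "m \<in> topspace M"
  obtains U \<sigma> where "local_section U \<sigma>" "m \<in> U"
proof -
  obtain U \<sigma> where U: "openin M U" "m \<in> U" "continuous_map (subtopology M U) (total P) \<sigma>"
    "\<forall>u\<in>U. proj P (\<sigma> u) = u"
    using local_sections_proj assms unfolding admits_local_sections_def by blast
  moreover have "\<sigma> u \<in> topspace (total P)" if "u \<in> U" for u
    using continuous_map_image_subset_topspace[OF U(3)] openin_subset[OF U(1)] that by auto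
  ultimately show ?thesis
    using that[of U \<sigma>] by (simp add: local_section_def)
qed

section \<open>Restriction to an anchor fibre\<close>

lemma restrict_bundle_simps [simp]:
  "total (restrict_bundle b P) = subtopology (total P) {p. anchor P p = b}"
  "proj (restrict_bundle b P) = proj P" "anchor (restrict_bundle b P) = anchor P"
  "act (restrict_bundle b P) = act P"
  by (simp_all add: restrict_bundle_def)

text \<open>Acting by an arrow moves the anchor from its target to its source, so arrows from
  \<open>b\<close> to \<open>b\<close> preserve the anchor fibre.\<close>

lemma right_groupoid_space_restrict_bundle:
  assumes b: "b \<in> topspace (Obj G)"
  shows "right_groupoid_space (stabilizer G b) (subtopology (total P) {p. anchor P p = b})
    (anchor P) (act P)"
proof -
  interpret H: topological_groupoid "stabilizer G b"
    by (rule topological_groupoid_stabilizer[OF b])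
  let ?X = "subtopology (total P) {p. anchor P p = b}"
  show ?thesis
  proof
    show X: "cg_space ?X"
      by (rule cg_space_fibre[OF cg_X continuous_anchor Hausdorff_Obj])
    show anchor: "continuous_map ?X (Obj (stabilizer G b)) (anchor P)"
      by (auto simp: continuous_map_in_subtopology continuous_anchor
          intro: continuous_map_from_subtopology)
    let ?D = "subtopology (kprod ?X (Arr (stabilizer G b)))
        {(x, g). anchor P x = tgt (stabilizer G b) g}"
    have D: "cg_space ?D"
      by (rule cg_space_fibre_product[OF X H.cg_Arr anchor H.continuous_tgt H.Hausdorff_Obj])
    have "continuous_map ?D (total P) fst" "continuous_map ?D (Arr G) snd"
      by (rule continuous_map_into_fulltopology[OF continuous_map_fst_subtopology_kprod])
        (rule continuous_map_Arr_stabilizerD[OF continuous_map_snd_subtopology_kprod])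
    then have "continuous_map ?D (total P) (\<lambda>z. act P (fst z) (snd z))"
      by (rule continuous_map_act[OF D]) auto
    then show "continuous_map ?D ?X (\<lambda>(x, g). act P x g)"
      by (auto simp: continuous_map_in_subtopology topspace_Arr_stabilizer case_prod_unfold)
  qed (auto simp: topspace_Arr_stabilizer act_ident act_act)
qed

text \<open>Transitivity makes the anchor fibre surject onto \<open>M\<close>: a point over
  \<open>m\<close> is moved into it by an arrow from \<open>b\<close> to the anchor of that point.
  The assumption on \<open>tgt G\<close> lets this arrow be chosen continuously.\<close>

lemma principal_bundle_except_paracompact_restrict_bundle:
  assumes b: "b \<in> topspace (Obj G)" and trans: "transitive_groupoid G"
    and sect: "admits_local_sections (source_fiber G b) (Obj G) (tgt G)"
  shows "principal_bundle_except_paracompact (stabilizer G b) M (restrict_bundle b P)"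
proof -
  let ?X = "subtopology (total P) {p. anchor P p = b}"
  interpret R: right_groupoid_space "stabilizer G b" ?X "anchor P" "act P"
    by (rule right_groupoid_space_restrict_bundle[OF b])
  have proj: "continuous_map ?X M (proj P)"
    by (rule continuous_map_from_subtopology[OF continuous_proj])
  have "principal_bundle_except_paracompact_axioms (stabilizer G b) M (restrict_bundle b P)"
  proof (intro principal_bundle_except_paracompact_axioms.intro, unfold restrict_bundle_simps)
    show "cg_space M" "paracompact_space M"
      by (rule cg_base paracompact_base)+
    show "continuous_map ?X M (proj P)"
      by (rule proj)
    show "proj P ` topspace ?X = topspace M"
    proof
      show "proj P ` topspace ?X \<subseteq> topspace M"
        by auto
      show "topspace M \<subseteq> proj P ` topspace ?X"
      proof
        fix m assume "m \<in> topspace M"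
        then obtain p where p: "p \<in> topspace (total P)" "proj P p = m"
          using surj_proj by force
        obtain g where "g \<in> topspace (Arr G)" "src G g = b" "tgt G g = anchor P p"
          using transitiveE[OF trans b anchor_in[OF p(1)]] .
        then have "act P p g \<in> topspace ?X" "proj P (act P p g) = m"
          using p by auto
        then show "m \<in> proj P ` topspace ?X"
          by blast
      qed
    qed
    show "admits_local_sections ?X M (proj P)"
      unfolding admits_local_sections_def
    proof
      fix m assume "m \<in> topspace M"
      then obtain U \<sigma> where sec: "local_section U \<sigma>" and "m \<in> U"
        using local_sectionE by blast
      note \<sigma> = local_sectionD(2-4)[OF sec]
      note U = local_sectionD(1)[OF sec] \<open>m \<in> U\<close>
      have "anchor P (\<sigma> m) \<in> topspace (Obj G)"
        using U \<sigma>(2) by simp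
      then obtain V \<tau> where V: "openin (Obj G) V" "anchor P (\<sigma> m) \<in> V"
        and \<tau>: "continuous_map (subtopology (Obj G) V) (source_fiber G b) \<tau>"
          "\<And>v. v \<in> V \<Longrightarrow> tgt G (\<tau> v) = v"
        using sect unfolding admits_local_sections_def by meson
      \<comment> \<open>Shrinking \<open>U\<close> keeps the anchor of \<open>\<sigma> u\<close> in
        the domain \<open>V\<close> of \<open>\<tau>\<close>. The arrow
        \<open>\<tau> (anchor P (\<sigma> u))\<close> then runs from \<open>b\<close> to the anchor
        of \<open>\<sigma> u\<close>, and acting by it gives the new section.\<close>
      define U' where "U' = {u \<in> topspace (subtopology M U). anchor P (\<sigma> u) \<in> V}"
      have a\<sigma>: "continuous_map (subtopology M U) (Obj G) (\<lambda>u. anchor P (\<sigma> u))"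
        using continuous_map_compose[OF \<sigma>(1) continuous_anchor] by (simp add: o_def)
      have "openin (subtopology M U) U'"
        unfolding U'_def by (rule openin_continuous_map_preimage[OF a\<sigma> V(1)])
      then have U'_open: "openin M U'"
        using U(1) openin_trans_full by blast
      have U'_sub: "U' \<subseteq> U"
        by (auto simp: U'_def)
      have cg: "cg_space (subtopology M U')"
        by (rule cg_space_open_subtopology[OF cg_base U'_open])
      have \<sigma>': "continuous_map (subtopology M U') (total P) \<sigma>"
        by (rule continuous_map_from_subtopology_mono[OF \<sigma>(1) U'_sub])
      have a': "continuous_map (subtopology M U') (subtopology (Obj G) V) (\<lambda>u. anchor P (\<sigma> u))"
        by (rule continuous_map_into_subtopology[OF continuous_map_from_subtopology_mono[OF a\<sigma> U'_sub]])
          (auto simp: U'_def)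
      have "continuous_map (subtopology M U') (source_fiber G b) (\<lambda>u. \<tau> (anchor P (\<sigma> u)))"
        using continuous_map_compose[OF a' \<tau>(1)] by (simp add: o_def)
      then have \<tau>': "continuous_map (subtopology M U') (Arr G) (\<lambda>u. \<tau> (anchor P (\<sigma> u)))"
        and src\<tau>: "\<And>u. u \<in> U' \<Longrightarrow> src G (\<tau> (anchor P (\<sigma> u))) = b"
        using openin_subset[OF U'_open]
        by (auto simp: source_fiber_def continuous_map_in_subtopology)
      have \<tau>_in: "\<tau> (anchor P (\<sigma> u)) \<in> topspace (Arr G)" if "u \<in> U'" for u
        using \<tau>' that openin_subset[OF U'_open] by (auto simp: continuous_map_def)
      have tgt\<tau>: "tgt G (\<tau> (anchor P (\<sigma> u))) = anchor P (\<sigma> u)" if "u \<in> U'" for u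
        using \<tau>(2) that by (simp add: U'_def)
      have "continuous_map (subtopology M U') (total P) (\<lambda>u. act P (\<sigma> u) (\<tau> (anchor P (\<sigma> u))))"
        by (rule continuous_map_act[OF cg \<sigma>' \<tau>']) (simp add: tgt\<tau>)
      then have "continuous_map (subtopology M U') ?X (\<lambda>u. act P (\<sigma> u) (\<tau> (anchor P (\<sigma> u))))"
        by (rule continuous_map_into_subtopology)
          (use U'_sub in \<open>auto simp: src\<tau> \<tau>_in tgt\<tau> \<sigma>(2) subset_iff\<close>)
      moreover have "\<forall>u\<in>U'. proj P (act P (\<sigma> u) (\<tau> (anchor P (\<sigma> u)))) = u"
        using U'_sub by (auto simp: \<tau>_in tgt\<tau> \<sigma>(2,3) subset_iff)
      moreover have "m \<in> U'"
        using U V openin_subset[OF U(1)] by (auto simp: U'_def)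
      ultimately show "\<exists>U \<sigma>. openin M U \<and> m \<in> U \<and> continuous_map (subtopology M U) ?X \<sigma> \<and>
          (\<forall>u\<in>U. proj P (\<sigma> u) = u)"
        using U'_open by (intro exI[of _ U'] exI conjI)
    qed
    show "homeomorphic_map
        (subtopology (kprod ?X (Arr (stabilizer G b))) {(p, g). anchor P p = tgt (stabilizer G b) g})
        (subtopology (kprod ?X ?X) {(p, q). proj P p = proj P q})
        (\<lambda>(p, g). (p, act P p g))"
    proof (rule R.homeomorphic_shearI[OF proj Hausdorff_base])
      show "g = g'" if "x \<in> topspace ?X" "g \<in> topspace (Arr (stabilizer G b))"
        "g' \<in> topspace (Arr (stabilizer G b))" "anchor P x = tgt (stabilizer G b) g"
        "anchor P x = tgt (stabilizer G b) g'" "act P x g = act P x g'" for x g g'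
        using act_left_cancel[OF that(6)] that by (simp add: topspace_Arr_stabilizer)
      \<comment> \<open>The division of \<open>P\<close> serves globally: between two points
        anchored at \<open>b\<close> it has source and target \<open>b\<close>, hence lies in the
        stabilizer. So \<open>W\<close> can be the whole base.\<close>
      let ?D = "subtopology (kprod ?X ?X) {(x, y). proj P x = proj P y \<and> proj P x \<in> topspace M}"
      have "cg_space ?D"
        by (rule cg_space_fibre_product_open[OF R.cg_X proj Hausdorff_base openin_topspace])
      moreover have "continuous_map ?D (total P) fst" "continuous_map ?D (total P) snd"
        by (rule continuous_map_into_fulltopology[OF continuous_map_fst_subtopology_kprod]
            continuous_map_into_fulltopology[OF continuous_map_snd_subtopology_kprod])+
      ultimately have "continuous_map ?D (Arr G) (\<lambda>z. division (fst z) (snd z))"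
        by (rule continuous_map_division) auto
      then have "continuous_map ?D (Arr (stabilizer G b)) (\<lambda>z. division (fst z) (snd z))"
        by (auto simp: continuous_map_Arr_stabilizer)
      then show "\<exists>W d. openin M W \<and> m \<in> W \<and>
          continuous_map (subtopology (kprod ?X ?X) {(x, y). proj P x = proj P y \<and> proj P x \<in> W})
            (Arr (stabilizer G b)) (\<lambda>z. d (fst z) (snd z)) \<and>
          (\<forall>x\<in>topspace ?X. \<forall>y\<in>topspace ?X. proj P x = proj P y \<and> proj P x \<in> W \<longrightarrow>
            anchor P x = tgt (stabilizer G b) (d x y) \<and> act P x (d x y) = y)"
        if "m \<in> topspace M" for m
        using that by (intro exI[of _ "topspace M"] exI[of _ division] conjI) auto
    qed (auto simp: topspace_Arr_stabilizer)
  qed (auto simp: topspace_Arr_stabilizer)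
  with R.right_groupoid_space_axioms show ?thesis
    by (simp add: principal_bundle_except_paracompact_def)
qed

end

section \<open>Extension of a stabilizer bundle\<close>

locale stabilizer_bundle =
  topological_groupoid G + Q: principal_bundle_except_paracompact "stabilizer G b" M Q
  for G :: "('o, 'a) groupoid" and b :: 'o and M :: "'m topology"
    and Q :: "('q, 'm, 'o, 'a) groupoid_bundle" +
  assumes base_object: "b \<in> topspace (Obj G)"
begin

abbreviation "E \<equiv> extend_bundle G b Q"
abbreviation "cls q g \<equiv> balanced_class G b Q (q, g)"

section \<open>The group action on \<open>Q\<close>, expressed through arrows of
  \<open>G\<close>\<close>

lemma mem_stabilizer [simp]:
  "h \<in> topspace (Arr (stabilizer G b)) \<longleftrightarrow> h \<in> topspace (Arr G) \<and> src G h = b \<and> tgt G h = b"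
  by (auto simp: topspace_Arr_stabilizer)

lemma mem_target_fiber [simp]:
  "g \<in> topspace (target_fiber G b) \<longleftrightarrow> g \<in> topspace (Arr G) \<and> tgt G g = b"
  by (auto simp: target_fiber_def)

lemma anchor_Q [simp]: "q \<in> topspace (total Q) \<Longrightarrow> anchor Q q = b"
  using Q.anchor_in[of q] by simp

lemma act_Q_in [simp]:
  "\<lbrakk>q \<in> topspace (total Q); h \<in> topspace (Arr G); src G h = b; tgt G h = b\<rbrakk>
    \<Longrightarrow> act Q q h \<in> topspace (total Q)"
  by (rule Q.act_in) simp_all

lemma proj_act_Q [simp]:
  "\<lbrakk>q \<in> topspace (total Q); h \<in> topspace (Arr G); src G h = b; tgt G h = b\<rbrakk>
    \<Longrightarrow> proj Q (act Q q h) = proj Q q"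
  by (rule Q.proj_act) simp_all

lemma act_act_Q [simp]:
  "\<lbrakk>q \<in> topspace (total Q); h \<in> topspace (Arr G); src G h = b; tgt G h = b;
    k \<in> topspace (Arr G); src G k = b; tgt G k = b\<rbrakk>
    \<Longrightarrow> act Q (act Q q h) k = act Q q (cmp G h k)"
  using Q.act_act[of q h k] by simp

lemma act_ident_Q [simp]: "q \<in> topspace (total Q) \<Longrightarrow> act Q q (ident G b) = q"
  using Q.act_ident[of q] by simp

lemma division_Q [simp]:
  assumes "p \<in> topspace (total Q)" "q \<in> topspace (total Q)" "proj Q p = proj Q q"
  shows "Q.division p q \<in> topspace (Arr G)" "src G (Q.division p q) = b"
    "tgt G (Q.division p q) = b"
  using Q.division_in[OF assms] by simp_all

section \<open>The balanced product as a set, with its projection, anchor and action\<close>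

lemma balanced_rel_iff:
  "((q', g'), (q, g)) \<in> balanced_rel G b Q \<longleftrightarrow>
    q \<in> topspace (total Q) \<and> q' \<in> topspace (total Q) \<and>
    g \<in> topspace (target_fiber G b) \<and> g' \<in> topspace (target_fiber G b) \<and>
    (\<exists>h. h \<in> topspace (Arr G) \<and> src G h = b \<and> tgt G h = b \<and> q' = act Q q h \<and> g = cmp G h g')"
  unfolding balanced_rel_def by auto

text \<open>The group laws of the stabilizer provide the witnesses: the identity at
  \<open>b\<close>, the inverse of \<open>h\<close>, and the composite of \<open>k\<close> after
  \<open>h\<close>.\<close>

lemma equiv_balanced_rel:
  "equiv (topspace (total Q) \<times> topspace (target_fiber G b)) (balanced_rel G b Q)"
proof (rule equivI)
  show "balanced_rel G b Q \<subseteq>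
      (topspace (total Q) \<times> topspace (target_fiber G b)) \<times>
      (topspace (total Q) \<times> topspace (target_fiber G b))"
    by (auto simp: balanced_rel_iff)
  show "refl_on (topspace (total Q) \<times> topspace (target_fiber G b)) (balanced_rel G b Q)"
  proof (rule refl_onI)
    fix x assume "x \<in> topspace (total Q) \<times> topspace (target_fiber G b)"
    then obtain q g where x: "x = (q, g)" "q \<in> topspace (total Q)" "g \<in> topspace (Arr G)" "tgt G g = b"
      by (cases x) simp
    then have "cmp G (ident G b) g = g"
      using cmp_ident_left[of g] by simp
    with x show "(x, x) \<in> balanced_rel G b Q"
      using base_object unfolding x(1) balanced_rel_iff
      by (intro conjI exI[of _ "ident G b"]) simp_all
  qed
  show "sym (balanced_rel G b Q)"
  proof (rule symI)
    fix x y assume "(x, y) \<in> balanced_rel G b Q"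
    then obtain q h g where "x = (act Q q h, g)" "y = (q, cmp G h g)" "q \<in> topspace (total Q)"
      "h \<in> topspace (Arr G)" "src G h = b" "tgt G h = b" "g \<in> topspace (Arr G)" "tgt G g = b"
      unfolding balanced_rel_def by auto
    note xy = this
    then show "(y, x) \<in> balanced_rel G b Q"
      unfolding xy(1,2) balanced_rel_iff by (intro conjI exI[of _ "invs G h"]) simp_all
  qed
  show "trans (balanced_rel G b Q)"
  proof (rule transI)
    fix x y z assume "(x, y) \<in> balanced_rel G b Q" and yz: "(y, z) \<in> balanced_rel G b Q"
    then obtain q h g where xy: "x = (act Q q h, g)" "y = (q, cmp G h g)" "q \<in> topspace (total Q)"
      "h \<in> topspace (Arr G)" "src G h = b" "tgt G h = b" "g \<in> topspace (Arr G)" "tgt G g = b"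
      unfolding balanced_rel_def by auto
    from yz xy obtain r k where "z = (r, cmp G k (cmp G h g))" "q = act Q r k"
      "r \<in> topspace (total Q)" "k \<in> topspace (Arr G)" "src G k = b" "tgt G k = b"
      unfolding balanced_rel_def by auto
    note z = this
    show "(x, z) \<in> balanced_rel G b Q"
      unfolding xy(1) z(1) balanced_rel_iff using xy(3-) z(2-)
      by (intro conjI exI[of _ "cmp G k h"]) (simp_all add: cmp_assoc)
  qed
qed

lemma balanced_class_eq_iff:
  assumes "q \<in> topspace (total Q)" "q' \<in> topspace (total Q)"
    "g \<in> topspace (Arr G)" "tgt G g = b" "g' \<in> topspace (Arr G)" "tgt G g' = b"
  shows "cls q' g' = cls q g \<longleftrightarrow>
    (\<exists>h. h \<in> topspace (Arr G) \<and> src G h = b \<and> tgt G h = b \<and> q' = act Q q h \<and> g = cmp G h g')"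
  unfolding balanced_class_def
  using eq_equiv_class_iff[OF equiv_balanced_rel, of "(q', g')" "(q, g)"] assms
  by (simp add: balanced_rel_iff)

lemma balanced_class_act:
  assumes "q \<in> topspace (total Q)" "h \<in> topspace (Arr G)" "src G h = b" "tgt G h = b"
    "g \<in> topspace (Arr G)" "tgt G g = b"
  shows "cls (act Q q h) g = cls q (cmp G h g)"
  using assms by (subst balanced_class_eq_iff) auto

lemma mem_balanced_class:
  "(q', g') \<in> cls q g \<longleftrightarrow> ((q, g), (q', g')) \<in> balanced_rel G b Q"
  by (simp add: balanced_class_def)

lemma total_extend:
  "total E = quotient_topology (kprod (total Q) (target_fiber G b)) (balanced_class G b Q)"
  by (simp add: extend_bundle_def)

lemma quotient_map_balanced_class:
  "quotient_map (kprod (total Q) (target_fiber G b)) (total E) (balanced_class G b Q)"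
  unfolding total_extend by (rule quotient_map_quotient_topology)

lemma balanced_class_in [simp]:
  "\<lbrakk>q \<in> topspace (total Q); g \<in> topspace (Arr G); tgt G g = b\<rbrakk> \<Longrightarrow> cls q g \<in> topspace (total E)"
  by (simp add: total_extend)

lemma extendE:
  assumes "c \<in> topspace (total E)"
  obtains q g where "c = cls q g" "q \<in> topspace (total Q)" "g \<in> topspace (Arr G)" "tgt G g = b"
  using assms by (auto simp: total_extend)

lemma mem_balanced_classE:
  assumes "(q', g') \<in> cls q g"
  obtains h where "h \<in> topspace (Arr G)" "src G h = b" "tgt G h = b" "q' \<in> topspace (total Q)"
    "act Q q' h = q" "g' = cmp G h g"
  using assms unfolding mem_balanced_class balanced_rel_iff by metis

text \<open>The relation is already an equivalence, so every member of a class is one balancing step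
  away from the given representative. Compatibility with a single step thus makes \<open>f\<close>
  constant on the class.\<close>

lemma the_elem_balanced_class:
  assumes "q \<in> topspace (total Q)" "g \<in> topspace (Arr G)" "tgt G g = b"
    and "\<And>q h g. \<lbrakk>q \<in> topspace (total Q); h \<in> topspace (Arr G); src G h = b; tgt G h = b;
      g \<in> topspace (Arr G); tgt G g = b\<rbrakk> \<Longrightarrow> f (q, cmp G h g) = f (act Q q h, g)"
  shows "the_elem (f ` cls q g) = f (q, g)"
proof (rule the_elem_image_unique)
  have "(q, g) \<in> cls q g"
    unfolding balanced_class_def using assms(1-3) by (intro equiv_class_self[OF equiv_balanced_rel]) simp
  then show "cls q g \<noteq> {}"
    by blast
  show "f y = f (q, g)" if "y \<in> cls q g" for y
    using that assms(4) by (cases y) (auto simp: mem_balanced_class balanced_rel_iff)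
qed

lemma proj_extend [simp]:
  assumes "q \<in> topspace (total Q)" "g \<in> topspace (Arr G)" "tgt G g = b"
  shows "proj E (cls q g) = proj Q q"
  using the_elem_balanced_class[OF assms, of "\<lambda>(q, g). proj Q q"] by (simp add: extend_bundle_def)

lemma anchor_extend [simp]:
  assumes "q \<in> topspace (total Q)" "g \<in> topspace (Arr G)" "tgt G g = b"
  shows "anchor E (cls q g) = src G g"
  using the_elem_balanced_class[OF assms, of "\<lambda>(q, g). src G g"] by (simp add: extend_bundle_def)

text \<open>Multiplying by the stabilizer on the left commutes with multiplying by \<open>k\<close>
  on the right. Translating all representatives therefore yields exactly the representatives of the
  new class.\<close>

lemma act_extend [simp]:
  assumes q: "q \<in> topspace (total Q)" and g: "g \<in> topspace (Arr G)" "tgt G g = b"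
    and k: "k \<in> topspace (Arr G)" "src G g = tgt G k"
  shows "act E (cls q g) k = cls q (cmp G g k)"
proof -
  have "(\<lambda>(q, g). (q, cmp G g k)) ` cls q g = cls q (cmp G g k)"
  proof (intro equalityI subsetI)
    fix y assume "y \<in> (\<lambda>(q, g). (q, cmp G g k)) ` cls q g"
    then obtain q' g' where "y = (q', cmp G g' k)" and mem: "(q', g') \<in> cls q g"
      by (elim imageE) auto
    with mem obtain h where y: "y = (q', cmp G (cmp G h g) k)" "act Q q' h = q"
      "q' \<in> topspace (total Q)" "h \<in> topspace (Arr G)" "src G h = b" "tgt G h = b"
      by (elim mem_balanced_classE) simp
    show "y \<in> cls q (cmp G g k)"
      unfolding y(1) mem_balanced_class balanced_rel_iff using assms y(3-)
      by (intro conjI exI[of _ h]) (simp_all add: cmp_assoc y(2))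
  next
    fix y assume "y \<in> cls q (cmp G g k)"
    then obtain q' h where y: "y = (q', cmp G h (cmp G g k))" "act Q q' h = q"
      "q' \<in> topspace (total Q)" "h \<in> topspace (Arr G)" "src G h = b" "tgt G h = b"
      by (cases y) (metis mem_balanced_classE)
    have "(q', cmp G h g) \<in> cls q g"
      unfolding mem_balanced_class balanced_rel_iff using assms y(3-)
      by (intro conjI exI[of _ h]) (simp_all add: y(2))
    moreover have "y = (q', cmp G (cmp G h g) k)"
      using assms y by (simp add: cmp_assoc)
    ultimately show "y \<in> (\<lambda>(q, g). (q, cmp G g k)) ` cls q g"
      by (intro image_eqI[where x="(q', cmp G h g)"]) simp_all
  qed
  then show ?thesis
    by (simp add: extend_bundle_def)
qed

section \<open>The topology of the balanced product\<close>

lemma cg_space_target_fiber: "cg_space (target_fiber G b)"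
  unfolding target_fiber_def by (rule cg_space_fibre[OF cg_Arr continuous_tgt Hausdorff_Obj])

lemma continuous_map_target_fiber:
  "continuous_map W (target_fiber G b) f \<longleftrightarrow>
    continuous_map W (Arr G) f \<and> (\<forall>w\<in>topspace W. tgt G (f w) = b)"
  by (auto simp: target_fiber_def continuous_map_in_subtopology)

lemma continuous_map_balanced_class:
  assumes "cg_space W" "continuous_map W (total Q) f" "continuous_map W (target_fiber G b) g"
  shows "continuous_map W (total E) (\<lambda>w. cls (f w) (g w))"
proof -
  have "continuous_map W (kprod (total Q) (target_fiber G b)) (\<lambda>w. (f w, g w))"
    using assms by (intro continuous_map_kprodI) (simp_all add: cg_space_def)
  from continuous_map_compose[OF this quotient_imp_continuous_map[OF quotient_map_balanced_class]]
  show ?thesis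
    by (simp add: o_def)
qed

lemma proj_E_in [simp]: "c \<in> topspace (total E) \<Longrightarrow> proj E c \<in> topspace M"
  by (elim extendE) simp

lemma continuous_proj_extend: "continuous_map (total E) M (proj E)"
proof (rule continuous_compose_quotient_map[OF quotient_map_balanced_class])
  have "continuous_map (kprod (total Q) (target_fiber G b)) M (proj Q \<circ> fst)"
    by (rule continuous_map_compose[OF continuous_map_fst_kprod Q.continuous_proj])
  then show "continuous_map (kprod (total Q) (target_fiber G b)) M (proj E \<circ> balanced_class G b Q)"
    by (rule continuous_map_eq) auto
qed

lemma continuous_anchor_extend: "continuous_map (total E) (Obj G) (anchor E)"
proof (rule continuous_compose_quotient_map[OF quotient_map_balanced_class])
  have "continuous_map (target_fiber G b) (Obj G) (src G)"
    unfolding target_fiber_def by (rule continuous_map_from_subtopology[OF continuous_src])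
  then have "continuous_map (kprod (total Q) (target_fiber G b)) (Obj G) (src G \<circ> snd)"
    by (rule continuous_map_compose[OF continuous_map_snd_kprod])
  then show "continuous_map (kprod (total Q) (target_fiber G b)) (Obj G)
      (anchor E \<circ> balanced_class G b Q)"
    by (rule continuous_map_eq) auto
qed

text \<open>
  A local section \<open>\<sigma>\<close> of \<open>Q\<close> over \<open>U\<close> trivializes the extension over
  \<open>U\<close>: every class there has a unique representative of the form
  \<open>(\<sigma> u, g)\<close>, and the coordinate is this \<open>g\<close>.
\<close>

definition coordinate :: "('m \<Rightarrow> 'q) \<Rightarrow> ('q \<times> 'a) set \<Rightarrow> 'a" where
  "coordinate \<sigma> c = the_elem ((\<lambda>(q, g). cmp G (Q.division (\<sigma> (proj Q q)) q) g) ` c)"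

context
  fixes U :: "'m set" and \<sigma> :: "'m \<Rightarrow> 'q"
  assumes \<sigma>: "Q.local_section U \<sigma>"
begin

lemmas section_open = Q.local_sectionD(1)[OF \<sigma>]
  and continuous_section = Q.local_sectionD(2)[OF \<sigma>]
  and section_simps [simp] = Q.local_sectionD(3,4)[OF \<sigma>]

text \<open>Passing from \<open>(q, h g)\<close> to \<open>(q h, g)\<close> changes the division by
  a right factor \<open>h\<close>, so that by associativity its composite with the second entry is
  unchanged.\<close>

lemma coordinate_balanced_class:
  assumes "q \<in> topspace (total Q)" "g \<in> topspace (Arr G)" "tgt G g = b" "proj Q q \<in> U"
  shows "coordinate \<sigma> (cls q g) = cmp G (Q.division (\<sigma> (proj Q q)) q) g"
proof -
  \<comment> \<open>\<open>the_elem_balanced_class\<close> asks for compatibility at every point of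
    \<open>Q\<close>, whereas \<open>\<sigma>\<close> is controlled only over \<open>U\<close>. The
    value \<open>undefined\<close> elsewhere makes the condition trivial there; on the class at hand
    the guard always holds.\<close>
  let ?f = "\<lambda>(q, g). if proj Q q \<in> U then cmp G (Q.division (\<sigma> (proj Q q)) q) g else undefined"
  have "the_elem (?f ` cls q g) = ?f (q, g)"
  proof (rule the_elem_balanced_class[OF assms(1-3)])
    fix q h g assume "q \<in> topspace (total Q)" "h \<in> topspace (Arr G)" "src G h = b" "tgt G h = b"
      "g \<in> topspace (Arr G)" "tgt G g = b"
    then show "?f (q, cmp G h g) = ?f (act Q q h, g)"
      using Q.division_act_right[of "\<sigma> (proj Q q)" q h] by (simp add: cmp_assoc)
  qed
  moreover have "?f ` cls q g = (\<lambda>(q, g). cmp G (Q.division (\<sigma> (proj Q q)) q) g) ` cls q g"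
  proof (rule image_cong[OF refl])
    fix y assume "y \<in> cls q g"
    then obtain q' g' where y: "y = (q', g')" "(q', g') \<in> cls q g"
      by (cases y) simp
    obtain h where "h \<in> topspace (Arr G)" "src G h = b" "tgt G h = b" "q' \<in> topspace (total Q)"
        "act Q q' h = q" "g' = cmp G h g"
      by (rule mem_balanced_classE[OF y(2)])
    then have "proj Q q' = proj Q q"
      using proj_act_Q[of q' h] by simp
    then show "?f y = (\<lambda>(q, g). cmp G (Q.division (\<sigma> (proj Q q)) q) g) y"
      using assms(4) by (simp add: y(1))
  qed
  ultimately show ?thesis
    using assms(4) by (simp add: coordinate_def)
qed

lemma coordinate:
  assumes "c \<in> topspace (total E)" "proj E c \<in> U"
  shows coordinate_in [simp]: "coordinate \<sigma> c \<in> topspace (Arr G)"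
    and tgt_coordinate [simp]: "tgt G (coordinate \<sigma> c) = b"
    and src_coordinate [simp]: "src G (coordinate \<sigma> c) = anchor E c"
    and balanced_class_coordinate: "cls (\<sigma> (proj E c)) (coordinate \<sigma> c) = c"
proof -
  obtain q g where c: "c = cls q g" "q \<in> topspace (total Q)" "g \<in> topspace (Arr G)" "tgt G g = b"
    using extendE[OF assms(1)] .
  then have q: "proj Q q \<in> U"
    using assms(2) by simp
  note coord = coordinate_balanced_class[OF c(2-4) q]
  show "coordinate \<sigma> c \<in> topspace (Arr G)" "tgt G (coordinate \<sigma> c) = b"
    "src G (coordinate \<sigma> c) = anchor E c"
    unfolding c(1) coord using c(2-4) q by simp_all
  \<comment> \<open>The division moves across the balance from the second entry to the first.
    \<open>act_division\<close> is withheld, since it would turn the acted point into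
    \<open>q\<close> before \<open>balanced_class_act\<close> could match.\<close>
  have "cls (\<sigma> (proj Q q)) (cmp G (Q.division (\<sigma> (proj Q q)) q) g) =
      cls (act Q (\<sigma> (proj Q q)) (Q.division (\<sigma> (proj Q q)) q)) g"
    using c(2-4) q by (simp add: balanced_class_act del: Q.act_division)
  then show "cls (\<sigma> (proj E c)) (coordinate \<sigma> c) = c"
    unfolding c(1) coord using c(2-4) q by simp
qed

text \<open>The part of the extension over \<open>U\<close> is open, so the quotient map restricts
  to a quotient map onto it. Continuity can then be tested on pairs \<open>(q, g)\<close>, where the
  coordinate is built from the section, the division map and composition.\<close>

lemma continuous_map_coordinate:
  "continuous_map (subtopology (total E) {c \<in> topspace (total E). proj E c \<in> U}) (target_fiber G b)
    (coordinate \<sigma>)"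
proof -
  let ?K = "kprod (total Q) (target_fiber G b)"
  let ?V = "{c \<in> topspace (total E). proj E c \<in> U}"
  let ?U = "{x \<in> topspace ?K. balanced_class G b Q x \<in> ?V}"
  have V: "openin (total E) ?V"
    by (rule openin_continuous_map_preimage[OF continuous_proj_extend section_open])
  then have quot: "quotient_map (subtopology ?K ?U) (subtopology (total E) ?V) (balanced_class G b Q)"
    by (intro quotient_map_restriction[OF quotient_map_balanced_class refl] disjI1)
  have "openin ?K ?U"
    by (rule openin_continuous_map_preimage
        [OF quotient_imp_continuous_map[OF quotient_map_balanced_class] V])
  then have cg: "cg_space (subtopology ?K ?U)"
    by (intro cg_space_open_subtopology cg_space_kprod Q.cg_X cg_space_target_fiber)
  have fst: "continuous_map (subtopology ?K ?U) (total Q) fst"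
    by (rule continuous_map_fst_subtopology_kprod)
  have snd: "continuous_map (subtopology ?K ?U) (Arr G) snd"
    using continuous_map_snd_subtopology_kprod[of "total Q" "target_fiber G b" ?U]
    by (simp only: continuous_map_target_fiber)
  have mem: "fst z \<in> topspace (total Q) \<and> snd z \<in> topspace (Arr G) \<and> tgt G (snd z) = b \<and>
      proj Q (fst z) \<in> U" if z: "z \<in> topspace (subtopology ?K ?U)" for z
  proof -
    obtain q g where qg: "z = (q, g)"
      by (cases z)
    have "q \<in> topspace (total Q)" "g \<in> topspace (Arr G)" "tgt G g = b" "proj E (cls q g) \<in> U"
      using z unfolding qg by (simp_all del: proj_extend)
    then show ?thesis
      unfolding qg by simp
  qed
  have "continuous_map (subtopology ?K ?U) (subtopology M U) (\<lambda>z. proj Q (fst z))"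
    using continuous_map_compose[OF fst Q.continuous_proj] mem
    by (auto simp: continuous_map_in_subtopology o_def)
  from continuous_map_compose[OF this continuous_section]
  have "continuous_map (subtopology ?K ?U) (total Q) (\<lambda>z. \<sigma> (proj Q (fst z)))"
    by (simp add: o_def)
  then have "continuous_map (subtopology ?K ?U) (Arr (stabilizer G b))
      (\<lambda>z. Q.division (\<sigma> (proj Q (fst z))) (fst z))"
    by (rule Q.continuous_map_division[OF cg _ fst]) (use mem in simp)
  then have "continuous_map (subtopology ?K ?U) (Arr G)
      (\<lambda>z. cmp G (Q.division (\<sigma> (proj Q (fst z))) (fst z)) (snd z))"
    by (intro continuous_map_cmp[OF cg continuous_map_Arr_stabilizerD snd]) (use mem in simp_all)
  then have "continuous_map (subtopology ?K ?U) (target_fiber G b)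
      (\<lambda>z. cmp G (Q.division (\<sigma> (proj Q (fst z))) (fst z)) (snd z))"
    using mem by (simp add: continuous_map_target_fiber del: topspace_subtopology)
  then have "continuous_map (subtopology ?K ?U) (target_fiber G b) (coordinate \<sigma> \<circ> balanced_class G b Q)"
  proof (rule continuous_map_eq)
    show "cmp G (Q.division (\<sigma> (proj Q (fst z))) (fst z)) (snd z) =
        (coordinate \<sigma> \<circ> balanced_class G b Q) z" if "z \<in> topspace (subtopology ?K ?U)" for z
      using mem[OF that] coordinate_balanced_class[of "fst z" "snd z"] by simp
  qed
  then show ?thesis
    by (rule continuous_compose_quotient_map[OF quot])
qed

lemma continuous_map_coordinate_compose:
  assumes "continuous_map W (total E) f" "\<And>w. w \<in> topspace W \<Longrightarrow> proj E (f w) \<in> U"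
  shows "continuous_map W (Arr G) (\<lambda>w. coordinate \<sigma> (f w))"
proof -
  have "continuous_map W (subtopology (total E) {c \<in> topspace (total E). proj E c \<in> U}) f"
    using assms continuous_map_image_subset_topspace[OF assms(1)]
    by (intro continuous_map_into_subtopology) auto
  from continuous_map_compose[OF this continuous_map_coordinate] show ?thesis
    by (simp add: o_def continuous_map_target_fiber)
qed

lemma continuous_map_section_compose:
  assumes "continuous_map W (total E) f" "\<And>w. w \<in> topspace W \<Longrightarrow> proj E (f w) \<in> U"
  shows "continuous_map W (total Q) (\<lambda>w. \<sigma> (proj E (f w)))"
proof -
  have "continuous_map W (subtopology M U) (\<lambda>w. proj E (f w))"
    using continuous_map_compose[OF assms(1) continuous_proj_extend] assms(2)
    by (auto simp: continuous_map_in_subtopology o_def)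
  from continuous_map_compose[OF this continuous_section] show ?thesis
    by (simp add: o_def)
qed

end

text \<open>Being a k-space passes to quotients. Points over different base points are separated by
  the projection. Over the same base point a coordinate separates them, because a class is
  determined by its projection and its coordinate.\<close>

lemma cg_space_extend: "cg_space (total E)"
proof -
  have "k_space (total E)"
    by (rule k_space_quotient_map_image[OF quotient_map_balanced_class k_space_kprod])
  moreover have "Hausdorff_space (total E)"
    unfolding Hausdorff_space_def
  proof (intro allI impI, elim conjE)
    fix c c' assume c: "c \<in> topspace (total E)" "c' \<in> topspace (total E)" "c \<noteq> c'"
    show "\<exists>U V. openin (total E) U \<and> openin (total E) V \<and> c \<in> U \<and> c' \<in> V \<and> disjnt U V"
    proof (cases "proj E c = proj E c'")
      case False
      then show ?thesis
        using c continuous_map_from_subtopology[OF continuous_proj_extend]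
        by (intro separated_by_continuous_map[OF openin_topspace _ _ _ _ Q.Hausdorff_base])
    next
      case True
      obtain U \<sigma> where \<sigma>: "Q.local_section U \<sigma>" and mU: "proj E c \<in> U"
        using Q.local_sectionE[OF proj_E_in[OF c(1)]] by blast
      note U = Q.local_sectionD(1)[OF \<sigma>] mU
      have ne: "coordinate \<sigma> c \<noteq> coordinate \<sigma> c'"
        using balanced_class_coordinate[OF \<sigma>, of c] balanced_class_coordinate[OF \<sigma>, of c']
          c U(2) True by metis
      have V: "openin (total E) {c \<in> topspace (total E). proj E c \<in> U}"
        by (rule openin_continuous_map_preimage[OF continuous_proj_extend U(1)])
      have "c \<in> {c \<in> topspace (total E). proj E c \<in> U}"
        "c' \<in> {c \<in> topspace (total E). proj E c \<in> U}"
        using c U(2) True by auto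
      moreover have "Hausdorff_space (target_fiber G b)"
        using cg_space_target_fiber by (simp add: cg_space_def)
      ultimately show ?thesis
        by (rule separated_by_continuous_map[where f="coordinate \<sigma>" and x=c and y=c', OF V _ _ continuous_map_coordinate[OF \<sigma>]
              ne])
    qed
  qed
  ultimately show ?thesis
    by (simp add: cg_space_def)
qed

text \<open>Over the domain of a section the action keeps the point \<open>\<sigma> u\<close> and
  multiplies the coordinate on the right, which gives its continuity; the algebraic laws are
  inherited from composition in \<open>G\<close>.\<close>

lemma right_groupoid_space_extend: "right_groupoid_space G (total E) (anchor E) (act E)"
proof
  show "cg_space (total E)"
    by (rule cg_space_extend)
  show "continuous_map (total E) (Obj G) (anchor E)"
    by (rule continuous_anchor_extend)
  let ?D = "subtopology (kprod (total E) (Arr G)) {(c, g). anchor E c = tgt G g}"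
  have D: "cg_space ?D"
    by (rule cg_space_fibre_product[OF cg_space_extend cg_Arr continuous_anchor_extend
          continuous_tgt Hausdorff_Obj])
  show "continuous_map ?D (total E) (\<lambda>(c, g). act E c g)"
  proof (rule continuous_map_locallyI)
    fix z assume z: "z \<in> topspace ?D"
    then have "proj E (fst z) \<in> topspace M"
      by auto
    then obtain U \<sigma> where \<sigma>: "Q.local_section U \<sigma>" and mU: "proj E (fst z) \<in> U"
      using Q.local_sectionE by blast
    note U = Q.local_sectionD(1)[OF \<sigma>] mU
    define N where "N = {w \<in> topspace ?D. proj E (fst w) \<in> U}"
    have "continuous_map ?D M (\<lambda>w. proj E (fst w))"
      using continuous_map_compose[OF continuous_map_fst_subtopology_kprod continuous_proj_extend]
      by (simp add: o_def)
    then have N: "openin ?D N"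
      unfolding N_def using U(1) by (rule openin_continuous_map_preimage)
    then have cg: "cg_space (subtopology ?D N)"
      by (rule cg_space_open_subtopology[OF D])
    have fst: "continuous_map (subtopology ?D N) (total E) fst"
      and snd: "continuous_map (subtopology ?D N) (Arr G) snd"
      by (rule continuous_map_from_subtopology continuous_map_fst_subtopology_kprod
          continuous_map_snd_subtopology_kprod)+
    have mem: "fst w \<in> topspace (total E) \<and> snd w \<in> topspace (Arr G) \<and>
        anchor E (fst w) = tgt G (snd w) \<and> proj E (fst w) \<in> U"
      if "w \<in> topspace (subtopology ?D N)" for w
      using that by (auto simp: N_def)
    have "continuous_map (subtopology ?D N) (Arr G) (\<lambda>w. cmp G (coordinate \<sigma> (fst w)) (snd w))"
      by (rule continuous_map_cmp[OF cg continuous_map_coordinate_compose[OF \<sigma> fst] snd])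
        (use mem src_coordinate[OF \<sigma>] in simp_all)
    then have "continuous_map (subtopology ?D N) (target_fiber G b)
        (\<lambda>w. cmp G (coordinate \<sigma> (fst w)) (snd w))"
      using mem coordinate[OF \<sigma>] by (simp add: continuous_map_target_fiber del: topspace_subtopology)
    then have "continuous_map (subtopology ?D N) (total E)
        (\<lambda>w. cls (\<sigma> (proj E (fst w))) (cmp G (coordinate \<sigma> (fst w)) (snd w)))"
      by (intro continuous_map_balanced_class[OF cg] continuous_map_section_compose[OF \<sigma> fst])
        (use mem in simp)
    then have "continuous_map (subtopology ?D N) (total E) (\<lambda>(c, g). act E c g)"
    proof (rule continuous_map_eq)
      fix w assume "w \<in> topspace (subtopology ?D N)"
      note w = mem[OF this]
      then have "act E (cls (\<sigma> (proj E (fst w))) (coordinate \<sigma> (fst w))) (snd w) =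
          cls (\<sigma> (proj E (fst w))) (cmp G (coordinate \<sigma> (fst w)) (snd w))"
        using coordinate[OF \<sigma>, of "fst w"] Q.local_sectionD(3)[OF \<sigma>] by (intro act_extend) simp_all
      then show "cls (\<sigma> (proj E (fst w))) (cmp G (coordinate \<sigma> (fst w)) (snd w)) =
          (case w of (c, g) \<Rightarrow> act E c g)"
        using w balanced_class_coordinate[OF \<sigma>, of "fst w"] by (simp add: case_prod_unfold)
    qed
    moreover have "z \<in> N"
      using z U(2) by (simp add: N_def)
    ultimately show "\<exists>U. openin ?D U \<and> z \<in> U \<and>
        continuous_map (subtopology ?D U) (total E) (\<lambda>(c, g). act E c g)"
      using N by (intro exI[of _ N] conjI)
  qed
  show "anchor E (act E c g) = src G g"
    if "c \<in> topspace (total E)" "g \<in> topspace (Arr G)" "anchor E c = tgt G g" for c g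
    using extendE[OF that(1)] by (metis that(2,3) act_extend anchor_extend cmp_in src_cmp tgt_cmp)
  show "act E c (ident G (anchor E c)) = c" if "c \<in> topspace (total E)" for c
    using that by (elim extendE) simp
  show "act E (act E c g) g' = act E c (cmp G g g')"
    if "c \<in> topspace (total E)" "g \<in> topspace (Arr G)" "g' \<in> topspace (Arr G)"
      "anchor E c = tgt G g" "src G g = tgt G g'" for c g g'
    using that by (elim extendE) (simp add: cmp_assoc)
qed

section \<open>The extension satisfies the bundle axioms\<close>

lemma principal_bundle_except_paracompact_extend:
  "principal_bundle_except_paracompact G M E"
proof -
  interpret E: right_groupoid_space G "total E" "anchor E" "act E"
    by (rule right_groupoid_space_extend)
  have proj_act_E: "proj E (act E c g) = proj E c"
    if "c \<in> topspace (total E)" "g \<in> topspace (Arr G)" "anchor E c = tgt G g" for c g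
    using that by (elim extendE) simp
  have "principal_bundle_except_paracompact_axioms G M E"
  proof
    show "cg_space M" "paracompact_space M"
      by (rule Q.cg_base Q.paracompact_base)+
    show "continuous_map (total E) M (proj E)"
      by (rule continuous_proj_extend)
    show "proj E ` topspace (total E) = topspace M"
    proof (intro equalityI subsetI)
      fix m assume "m \<in> topspace M"
      then obtain q where q: "q \<in> topspace (total Q)" "proj Q q = m"
        using Q.surj_proj by force
      then have "cls q (ident G b) \<in> topspace (total E)" "proj E (cls q (ident G b)) = m"
        using base_object by simp_all
      then show "m \<in> proj E ` topspace (total E)"
        by blast
    qed auto
    show "admits_local_sections (total E) M (proj E)"
      unfolding admits_local_sections_def
    proof
      fix m assume "m \<in> topspace M"
      then obtain U \<sigma> where \<sigma>: "Q.local_section U \<sigma>" and mU: "m \<in> U"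
        using Q.local_sectionE by blast
      note U = Q.local_sectionD(1)[OF \<sigma>] mU
      have "continuous_map (subtopology M U) (total E) (\<lambda>u. cls (\<sigma> u) (ident G b))"
        using base_object
        by (intro continuous_map_balanced_class[OF cg_space_open_subtopology[OF Q.cg_base U(1)]
              Q.local_sectionD(2)[OF \<sigma>]])
          (simp add: continuous_map_target_fiber)
      moreover have "\<forall>u\<in>U. proj E (cls (\<sigma> u) (ident G b)) = u"
        using Q.local_sectionD(3,4)[OF \<sigma>] base_object by simp
      ultimately show "\<exists>U \<sigma>. openin M U \<and> m \<in> U \<and> continuous_map (subtopology M U) (total E) \<sigma> \<and>
          (\<forall>u\<in>U. proj E (\<sigma> u) = u)"
        using U by (intro exI[of _ U] exI conjI)
    qed
    show "proj E (act E c g) = proj E c"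
      if "c \<in> topspace (total E)" "g \<in> topspace (Arr G)" "anchor E c = tgt G g" for c g
      by (rule proj_act_E[OF that])
    show "homeomorphic_map
        (subtopology (kprod (total E) (Arr G)) {(c, g). anchor E c = tgt G g})
        (subtopology (kprod (total E) (total E)) {(c, c'). proj E c = proj E c'})
        (\<lambda>(c, g). (c, act E c g))"
    proof (rule E.homeomorphic_shearI[OF continuous_proj_extend Q.Hausdorff_base proj_act_E])
      fix c k k' assume c: "c \<in> topspace (total E)" and k: "k \<in> topspace (Arr G)"
        "k' \<in> topspace (Arr G)" "anchor E c = tgt G k" "anchor E c = tgt G k'"
        and eq: "act E c k = act E c k'"
      obtain q g where qg: "c = cls q g" "q \<in> topspace (total Q)" "g \<in> topspace (Arr G)" "tgt G g = b"
        using extendE[OF c] .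
      have k': "src G g = tgt G k" "src G g = tgt G k'"
        using k qg by simp_all
      \<comment> \<open>Both classes are represented with the same first entry \<open>q\<close>, so
        the stabilizer arrow relating them fixes \<open>q\<close>. Freeness of the action on
        \<open>Q\<close> makes it the identity, and \<open>g\<close> can be cancelled.\<close>
      have "cls q (cmp G g k) = cls q (cmp G g k')"
        using eq k' k(1,2) qg by simp
      then obtain h where h: "h \<in> topspace (Arr G)" "src G h = b" "tgt G h = b"
        "q = act Q q h" "cmp G g k' = cmp G h (cmp G g k)"
        using k' k(1,2) qg by (subst (asm) balanced_class_eq_iff) auto
      have "h = ident G b"
        by (rule Q.act_left_cancel[of q]) (use h qg base_object in simp_all)
      then have "cmp G g k' = cmp G g k"
        using h(5) k' k qg cmp_ident_left[of "cmp G g k"] by simp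
      then show "k = k'"
        using cmp_left_cancel[of g k' k] qg k k' by simp
    next
      fix m assume "m \<in> topspace M"
      then obtain U \<sigma> where \<sigma>: "Q.local_section U \<sigma>" and mU: "m \<in> U"
        using Q.local_sectionE by blast
      note U = Q.local_sectionD(1)[OF \<sigma>] mU
      note coord = coordinate[OF \<sigma>]
      let ?D = "subtopology (kprod (total E) (total E)) {(x, y). proj E x = proj E y \<and> proj E x \<in> U}"
      \<comment> \<open>Relative to \<open>\<sigma>\<close> both classes have the same first entry,
        hence they differ only in their coordinates; this arrow carries the first coordinate to the
        second by right multiplication.\<close>
      let ?d = "\<lambda>c c'. cmp G (invs G (coordinate \<sigma> c)) (coordinate \<sigma> c')"
      have D: "cg_space ?D"
        by (rule cg_space_fibre_product_open[OF cg_space_extend continuous_proj_extend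
              Q.Hausdorff_base U(1)])
      have mem: "fst w \<in> topspace (total E) \<and> snd w \<in> topspace (total E) \<and>
          proj E (fst w) \<in> U \<and> proj E (snd w) \<in> U" if "w \<in> topspace ?D" for w
        using that by auto
      have "continuous_map ?D (Arr G) (\<lambda>w. coordinate \<sigma> (fst w))"
        by (rule continuous_map_coordinate_compose[OF \<sigma> continuous_map_fst_subtopology_kprod])
          (use mem in blast)
      moreover have "continuous_map ?D (Arr G) (\<lambda>w. coordinate \<sigma> (snd w))"
        by (rule continuous_map_coordinate_compose[OF \<sigma> continuous_map_snd_subtopology_kprod])
          (use mem in blast)
      ultimately have "continuous_map ?D (Arr G) (\<lambda>w. ?d (fst w) (snd w))"
        using mem coord by (intro continuous_map_cmp[OF D] continuous_map_invs) auto
      moreover have "anchor E x = tgt G (?d x y) \<and> act E x (?d x y) = y"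
        if xy: "x \<in> topspace (total E)" "y \<in> topspace (total E)" "proj E x = proj E y" "proj E x \<in> U"
        for x y
      proof -
        have y: "proj E y \<in> U"
          using xy by simp
        note cx = coord[OF xy(1,4)] and cy = coord[OF xy(2) y]
        have "act E (cls (\<sigma> (proj E x)) (coordinate \<sigma> x)) (?d x y) =
            cls (\<sigma> (proj E x)) (cmp G (coordinate \<sigma> x) (?d x y))"
          by (rule act_extend) (use cx(1,2) cy(1,2) Q.local_sectionD(3)[OF \<sigma> xy(4)] in simp_all)
        also have "cmp G (coordinate \<sigma> x) (?d x y) = coordinate \<sigma> y"
          using cx(1,2) cy(1,2) by simp
        finally have "act E x (?d x y) = y"
          using cx(4) cy(4) xy(3) by simp
        then show ?thesis
          using cx(1-3) cy(1,2) by simp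
      qed
      then have "\<forall>x\<in>topspace (total E). \<forall>y\<in>topspace (total E).
          proj E x = proj E y \<and> proj E x \<in> U \<longrightarrow>
          anchor E x = tgt G (?d x y) \<and> act E x (?d x y) = y"
        by blast
      ultimately show "\<exists>W d. openin M W \<and> m \<in> W \<and>
          continuous_map (subtopology (kprod (total E) (total E))
            {(x, y). proj E x = proj E y \<and> proj E x \<in> W}) (Arr G) (\<lambda>z. d (fst z) (snd z)) \<and>
          (\<forall>x\<in>topspace (total E). \<forall>y\<in>topspace (total E). proj E x = proj E y \<and> proj E x \<in> W \<longrightarrow>
            anchor E x = tgt G (d x y) \<and> act E x (d x y) = y)"
        using U by (intro exI[of _ U] exI[of _ ?d] conjI)
    qed
  qed
  with E.right_groupoid_space_axioms show ?thesis
    by (simp add: principal_bundle_except_paracompact_def)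
qed

end

section \<open>Isomorphisms\<close>

text \<open>
  The inverse is continuous because over the domain of a local section \<open>\<sigma>\<close> it sends
  \<open>q\<close> to \<open>\<sigma> u\<close> acted on by the division of \<open>q\<close> by
  \<open>f (\<sigma> u)\<close>, where \<open>u\<close> is the projection of \<open>q\<close>.
\<close>

lemma bundle_isomorphismI:
  assumes P: "principal_bundle_except_paracompact G M P"
    and Q: "principal_bundle_except_paracompact G M Q"
    and cont: "continuous_map (total P) (total Q) f"
    and proj: "\<And>p. p \<in> topspace (total P) \<Longrightarrow> proj Q (f p) = proj P p"
    and anchor: "\<And>p. p \<in> topspace (total P) \<Longrightarrow> anchor Q (f p) = anchor P p"
    and equivariant: "\<And>p g. \<lbrakk>p \<in> topspace (total P); g \<in> topspace (Arr G); anchor P p = tgt G g\<rbrakk>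
      \<Longrightarrow> f (act P p g) = act Q (f p) g"
  shows "bundle_isomorphism G P Q f"
proof -
  interpret P: principal_bundle_except_paracompact G M P by (rule P)
  interpret Q: principal_bundle_except_paracompact G M Q by (rule Q)
  have f_in: "f p \<in> topspace (total Q)" if "p \<in> topspace (total P)" for p
    using continuous_map_image_subset_topspace[OF cont] that by blast
  have inj: "inj_on f (topspace (total P))"
  proof (rule inj_onI)
    fix p q assume pq: "p \<in> topspace (total P)" "q \<in> topspace (total P)" and eq: "f p = f q"
    have [simp]: "proj P p = proj P q"
      using proj[OF pq(1)] proj[OF pq(2)] eq by simp
    have d: "P.division p q \<in> topspace (Arr G)" "tgt G (P.division p q) = anchor P p"
      "act P p (P.division p q) = q"
      using pq by simp_all
    \<comment> \<open>As \<open>f p\<close> and \<open>f q\<close> coincide, the arrow from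
      \<open>p\<close> to \<open>q\<close> fixes \<open>f p\<close>; freeness in \<open>Q\<close>
      forces it to be an identity.\<close>
    have "act Q (f p) (P.division p q) = f (act P p (P.division p q))"
      using equivariant[OF pq(1) d(1)] d(2) by simp
    also have "\<dots> = act Q (f p) (ident G (anchor P p))"
      using d(3) eq Q.act_ident[OF f_in[OF pq(1)]] anchor[OF pq(1)] by simp
    finally have "P.division p q = ident G (anchor P p)"
      by (rule Q.act_left_cancel) (use pq d f_in anchor in simp_all)
    then show "p = q"
      using d(3) P.act_ident[OF pq(1)] by simp
  qed
  \<comment> \<open>An explicit preimage of \<open>q\<close>: move \<open>p\<close> by the arrow
    from \<open>f p\<close> to \<open>q\<close>. It yields surjectivity now and the local formula
    for the inverse later.\<close>
  have lift: "act P p (Q.division (f p) q) \<in> topspace (total P) \<and> f (act P p (Q.division (f p) q)) = q"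
    if p: "p \<in> topspace (total P)" and q: "q \<in> topspace (total Q)" and pq: "proj P p = proj Q q" for p q
  proof -
    have "proj Q (f p) = proj Q q"
      using proj[OF p] pq by simp
    note d = Q.division[OF f_in[OF p] q this]
    show ?thesis
      using equivariant[OF p d(1)] d(2,3) anchor[OF p] p P.act_in[OF p d(1)] by simp
  qed
  have surj: "f ` topspace (total P) = topspace (total Q)"
  proof (intro equalityI subsetI)
    fix q assume q: "q \<in> topspace (total Q)"
    then have "proj Q q \<in> proj P ` topspace (total P)"
      using P.surj_proj by simp
    then obtain p where "p \<in> topspace (total P)" "proj P p = proj Q q"
      by (elim imageE) simp
    from lift[OF this(1) q this(2)] show "q \<in> f ` topspace (total P)"
      by (metis imageI)
  qed (use f_in in blast)
  define k where "k = the_inv_into (topspace (total P)) f"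
  have k_eq: "k (f p) = p" if "p \<in> topspace (total P)" for p
    unfolding k_def by (rule the_inv_into_f_f[OF inj that])
  have f_k: "f (k q) = q" if "q \<in> topspace (total Q)" for q
    unfolding k_def using that surj by (intro f_the_inv_into_f[OF inj]) simp
  have "continuous_map (total Q) (total P) k"
  proof (rule continuous_map_locallyI)
    fix q assume q: "q \<in> topspace (total Q)"
    then obtain U \<sigma> where \<sigma>: "P.local_section U \<sigma>" and qU: "proj Q q \<in> U"
      using P.local_sectionE[OF Q.proj_in] by blast
    note sec = P.local_sectionD[OF \<sigma>]
    define N where "N = {q \<in> topspace (total Q). proj Q q \<in> U}"
    have N: "openin (total Q) N"
      unfolding N_def by (rule openin_continuous_map_preimage[OF Q.continuous_proj sec(1)])
    have cg: "cg_space (subtopology (total Q) N)"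
      by (rule cg_space_open_subtopology[OF Q.cg_X N])
    have mem: "w \<in> topspace (total Q) \<and> proj Q w \<in> U"
      if "w \<in> topspace (subtopology (total Q) N)" for w
      using that by (simp add: N_def)
    have id: "continuous_map (subtopology (total Q) N) (total Q) (\<lambda>q. q)"
      by (intro continuous_map_from_subtopology) simp
    have "continuous_map (subtopology (total Q) N) (subtopology M U) (proj Q)"
      using mem by (intro continuous_map_into_subtopology continuous_map_from_subtopology
          Q.continuous_proj) blast
    from continuous_map_compose[OF this sec(2)]
    have \<sigma>N: "continuous_map (subtopology (total Q) N) (total P) (\<lambda>q. \<sigma> (proj Q q))"
      by (simp add: o_def)
    from continuous_map_compose[OF this cont]
    have "continuous_map (subtopology (total Q) N) (total Q) (\<lambda>q. f (\<sigma> (proj Q q)))"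
      by (simp add: o_def)
    then have d: "continuous_map (subtopology (total Q) N) (Arr G)
        (\<lambda>q. Q.division (f (\<sigma> (proj Q q))) q)"
      by (rule Q.continuous_map_division[OF cg _ id]) (use mem sec proj in simp)
    have "continuous_map (subtopology (total Q) N) (total P)
        (\<lambda>q. act P (\<sigma> (proj Q q)) (Q.division (f (\<sigma> (proj Q q))) q))"
      by (rule P.continuous_map_act[OF cg \<sigma>N d])
        (use mem sec f_in proj anchor in simp)
    then have "continuous_map (subtopology (total Q) N) (total P) k"
    proof (rule continuous_map_eq)
      fix w assume "w \<in> topspace (subtopology (total Q) N)"
      then have w: "w \<in> topspace (total Q)" "proj Q w \<in> U"
        using mem by blast+
      from lift[OF sec(3)[OF w(2)] w(1) sec(4)[OF w(2)]]
      show "act P (\<sigma> (proj Q w)) (Q.division (f (\<sigma> (proj Q w))) w) = k w"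
        by (metis k_eq)
    qed
    moreover have "q \<in> N"
      using q qU by (simp add: N_def)
    ultimately show "\<exists>U. openin (total Q) U \<and> q \<in> U \<and>
        continuous_map (subtopology (total Q) U) (total P) k"
      using N by blast
  qed
  then have "homeomorphic_maps (total P) (total Q) f k"
    unfolding homeomorphic_maps_def using cont k_eq f_k by blast
  then have "homeomorphic_map (total P) (total Q) f"
    unfolding homeomorphic_map_maps by blast
  then show ?thesis
    unfolding bundle_isomorphism_def using proj anchor equivariant by blast
qed

text \<open>Allows the comparison of \<open>Q\<close> with the restricted extension to be built in
  its natural direction, into the quotient, and stated in the other. That \<open>P\<close> is closed
  under its action is used when the inverse is applied to an acted point.\<close>

lemma bundle_isomorphic_sym:
  assumes P: "right_groupoid_space G (total P) (anchor P) (act P)"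
    and iso: "bundle_isomorphic G P Q"
  shows "bundle_isomorphic G Q P"
proof -
  interpret P: right_groupoid_space G "total P" "anchor P" "act P" by (rule P)
  obtain f where f: "homeomorphic_map (total P) (total Q) f"
    and pa: "\<And>p. p \<in> topspace (total P) \<Longrightarrow> proj Q (f p) = proj P p \<and> anchor Q (f p) = anchor P p"
    and equi: "\<And>p g. \<lbrakk>p \<in> topspace (total P); g \<in> topspace (Arr G); anchor P p = tgt G g\<rbrakk>
      \<Longrightarrow> f (act P p g) = act Q (f p) g"
    using iso unfolding bundle_isomorphic_def bundle_isomorphism_def by blast
  obtain k where fk: "homeomorphic_maps (total P) (total Q) f k"
    using f unfolding homeomorphic_map_maps by blast
  then have k: "homeomorphic_map (total Q) (total P) k"
    and kf: "\<And>p. p \<in> topspace (total P) \<Longrightarrow> k (f p) = p"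
    and fk: "\<And>q. q \<in> topspace (total Q) \<Longrightarrow> f (k q) = q"
    by (simp_all add: homeomorphic_maps_map)
  have k_in: "k q \<in> topspace (total P)" if "q \<in> topspace (total Q)" for q
    using homeomorphic_imp_surjective_map[OF k] that by blast
  have "proj P (k q) = proj Q q \<and> anchor P (k q) = anchor Q q" if "q \<in> topspace (total Q)" for q
    using pa[OF k_in[OF that]] fk[OF that] by simp
  moreover have "k (act Q q g) = act P (k q) g"
    if q: "q \<in> topspace (total Q)" and g: "g \<in> topspace (Arr G)" "anchor Q q = tgt G g" for q g
  proof -
    have a: "anchor P (k q) = tgt G g"
      using pa[OF k_in[OF q]] fk[OF q] g(2) by simp
    then have "f (act P (k q) g) = act Q q g"
      using equi[OF k_in[OF q] g(1)] fk[OF q] by simp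
    then show ?thesis
      using kf[OF P.act_in[OF k_in[OF q] g(1) a]] by simp
  qed
  ultimately have "bundle_isomorphism G Q P k"
    unfolding bundle_isomorphism_def using k by blast
  then show ?thesis
    unfolding bundle_isomorphic_def by blast
qed

context stabilizer_bundle
begin

text \<open>Equivariance is the computation \<open>[q h, 1] = [q, h] = [q, 1] h\<close>, the first
  equality being the balancing relation.\<close>

lemma bundle_isomorphic_restrict_extend:
  assumes "transitive_groupoid G" "admits_local_sections (source_fiber G b) (Obj G) (tgt G)"
  shows "bundle_isomorphic (stabilizer G b) (restrict_bundle b E) Q"
proof -
  interpret E: principal_bundle_except_paracompact G M E
    by (rule principal_bundle_except_paracompact_extend)
  interpret R: principal_bundle_except_paracompact "stabilizer G b" M "restrict_bundle b E"
    by (rule E.principal_bundle_except_paracompact_restrict_bundle[OF base_object assms])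
  have ident: "ident G b \<in> topspace (Arr G)" "src G (ident G b) = b" "tgt G (ident G b) = b"
    using base_object by simp_all
  have "bundle_isomorphism (stabilizer G b) Q (restrict_bundle b E) (\<lambda>q. cls q (ident G b))"
  proof (rule bundle_isomorphismI)
    show "principal_bundle_except_paracompact (stabilizer G b) M Q"
      "principal_bundle_except_paracompact (stabilizer G b) M (restrict_bundle b E)"
      by unfold_locales
    have "continuous_map (total Q) (total E) (\<lambda>q. cls q (ident G b))"
      using ident by (intro continuous_map_balanced_class[OF Q.cg_X])
        (simp_all add: continuous_map_target_fiber)
    then show "continuous_map (total Q) (total (restrict_bundle b E)) (\<lambda>q. cls q (ident G b))"
      using ident by (auto simp: continuous_map_in_subtopology)
    show "proj (restrict_bundle b E) (cls q (ident G b)) = proj Q q"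
      "anchor (restrict_bundle b E) (cls q (ident G b)) = anchor Q q"
      if "q \<in> topspace (total Q)" for q
      using that ident by simp_all
    show "cls (act Q q h) (ident G b) = act (restrict_bundle b E) (cls q (ident G b)) h"
      if "q \<in> topspace (total Q)" "h \<in> topspace (Arr (stabilizer G b))"
        "anchor Q q = tgt (stabilizer G b) h" for q h
    proof -
      have h: "h \<in> topspace (Arr G)" "src G h = b" "tgt G h = b"
        using that(2) by simp_all
      then have "cmp G h (ident G b) = h" "cmp G (ident G b) h = h"
        using cmp_ident_right[of h] cmp_ident_left[of h] by simp_all
      then show ?thesis
        using that(1) h ident by (simp add: balanced_class_act)
    qed
  qed
  then have "bundle_isomorphic (stabilizer G b) Q (restrict_bundle b E)"
    unfolding bundle_isomorphic_def by blast
  then show ?thesis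
    by (rule bundle_isomorphic_sym[OF Q.right_groupoid_space_axioms])
qed

end

context principal_bundle_except_paracompact
begin

lemma bundle_isomorphic_extend_restrict:
  assumes b: "b \<in> topspace (Obj G)" and "transitive_groupoid G"
    and "admits_local_sections (source_fiber G b) (Obj G) (tgt G)"
  shows "bundle_isomorphic G (extend_bundle G b (restrict_bundle b P)) P"
proof -
  let ?R = "restrict_bundle b P"
  interpret R: principal_bundle_except_paracompact "stabilizer G b" M ?R
    by (rule principal_bundle_except_paracompact_restrict_bundle[OF assms])
  interpret S: stabilizer_bundle G b M ?R
    by unfold_locales (rule b)
  interpret E: principal_bundle_except_paracompact G M "extend_bundle G b ?R"
    by (rule S.principal_bundle_except_paracompact_extend)
  \<comment> \<open>Evaluation of the action. It is well defined because
    \<open>(p h) g = p (h g)\<close>, and its continuity descends along the quotient map from pairs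
    \<open>(p, g)\<close>.\<close>
  define f where "f c = the_elem ((\<lambda>(p, g). act P p g) ` c)" for c
  have f: "f (balanced_class G b ?R (p, g)) = act P p g"
    if "p \<in> topspace (total P)" "anchor P p = b" "g \<in> topspace (Arr G)" "tgt G g = b" for p g
    unfolding f_def
    using S.the_elem_balanced_class[of p g "\<lambda>(p, g). act P p g"] that by (simp add: act_act)
  have "bundle_isomorphism G (extend_bundle G b ?R) P f"
  proof (rule bundle_isomorphismI)
    show "principal_bundle_except_paracompact G M (extend_bundle G b ?R)"
      "principal_bundle_except_paracompact G M P"
      by unfold_locales
    let ?K = "kprod (total ?R) (target_fiber G b)"
    show "continuous_map (total (extend_bundle G b ?R)) (total P) f"
    proof (rule continuous_compose_quotient_map[OF S.quotient_map_balanced_class])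
      have K: "cg_space ?K"
        by (intro cg_space_kprod R.cg_X S.cg_space_target_fiber)
      have fst: "continuous_map ?K (total P) fst"
        using continuous_map_fst_kprod[of "total ?R" "target_fiber G b"]
        by (simp add: continuous_map_in_subtopology)
      have snd: "continuous_map ?K (Arr G) snd"
        using continuous_map_snd_kprod[of "total ?R" "target_fiber G b"]
        by (simp add: S.continuous_map_target_fiber)
      have mem: "fst z \<in> topspace (total P) \<and> anchor P (fst z) = b \<and>
          snd z \<in> topspace (Arr G) \<and> tgt G (snd z) = b" if "z \<in> topspace ?K" for z
        using that by (cases z) simp
      have "continuous_map ?K (total P) (\<lambda>z. act P (fst z) (snd z))"
        by (rule continuous_map_act[OF K fst snd]) (use mem in simp)
      then show "continuous_map ?K (total P) (f \<circ> balanced_class G b ?R)"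
      proof (rule continuous_map_eq)
        show "act P (fst z) (snd z) = (f \<circ> balanced_class G b ?R) z" if "z \<in> topspace ?K" for z
          using f[of "fst z" "snd z"] mem[OF that] by simp
      qed
    qed
    fix c assume "c \<in> topspace (total (extend_bundle G b ?R))"
    then obtain p g where c: "c = balanced_class G b ?R (p, g)"
      and pg: "p \<in> topspace (total P)" "anchor P p = b" "g \<in> topspace (Arr G)" "tgt G g = b"
      by (elim S.extendE) simp
    then have p: "p \<in> topspace (total ?R)"
      by simp
    show "proj P (f c) = proj (extend_bundle G b ?R) c"
      "anchor P (f c) = anchor (extend_bundle G b ?R) c"
      unfolding c using pg S.proj_extend[OF p pg(3,4)] S.anchor_extend[OF p pg(3,4)]
      by (simp_all add: f)
    fix k assume k: "k \<in> topspace (Arr G)" "anchor (extend_bundle G b ?R) c = tgt G k"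
    then have gk: "src G g = tgt G k"
      unfolding c S.anchor_extend[OF p pg(3,4)] by simp
    show "f (act (extend_bundle G b ?R) c k) = act P (f c) k"
      unfolding c S.act_extend[OF p pg(3,4) k(1) gk] using pg k(1) gk by (simp add: f act_act)
  qed
  then show ?thesis
    unfolding bundle_isomorphic_def by blast
qed

end

section \<open>Transfer of paracompactness, and the correspondence itself\<close>

lemma bundle_isomorphic_paracompact_space:
  assumes "bundle_isomorphic G P Q"
  shows "paracompact_space (total P) \<longleftrightarrow> paracompact_space (total Q)"
  using assms homeomorphic_map_paracompact_space
  unfolding bundle_isomorphic_def bundle_isomorphism_def homeomorphic_map_maps
  by (metis homeomorphic_maps_sym)

text \<open>The form reflects where paracompactness comes from. A restriction inherits it as a
  closed subspace, and extending that restriction gives a space homeomorphic to the original total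
  space. For an arbitrary \<open>Q\<close> the total space of the extension may fail to be
  paracompact, as pair groupoids show, so this condition is a premise of the full
  \<open>principal_bundle\<close> claim there, while the other axioms and the isomorphism are
  unconditional.\<close>

theorem proposition5p4:
  fixes G :: "('o, 'a) groupoid" and b :: 'o and M :: "'m topology"
  assumes "topological_groupoid G"
    and "transitive_groupoid G"
    and "b \<in> topspace (Obj G)"
    and "admits_local_sections (source_fiber G b) (Obj G) (tgt G)"
  shows
    "(\<forall>P :: ('p, 'm, 'o, 'a) groupoid_bundle.
        principal_bundle G M P \<and> b \<in> anchor P ` topspace (total P) \<longrightarrow>
          principal_bundle (stabilizer G b) M (restrict_bundle b P) \<and>
          principal_bundle G M (extend_bundle G b (restrict_bundle b P)) \<and>
          bundle_isomorphic G (extend_bundle G b (restrict_bundle b P)) P) \<and>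
     (\<forall>Q :: ('q, 'm, 'o, 'a) groupoid_bundle.
        principal_bundle (stabilizer G b) M Q \<longrightarrow>
          principal_bundle_except_paracompact G M (extend_bundle G b Q) \<and>
          (paracompact_space (total (extend_bundle G b Q)) \<longrightarrow>
             principal_bundle G M (extend_bundle G b Q)) \<and>
          principal_bundle (stabilizer G b) M (restrict_bundle b (extend_bundle G b Q)) \<and>
          bundle_isomorphic (stabilizer G b) (restrict_bundle b (extend_bundle G b Q)) Q)"
proof (rule conjI; intro allI impI)
  fix P :: "('p, 'm, 'o, 'a) groupoid_bundle"
  assume "principal_bundle G M P \<and> b \<in> anchor P ` topspace (total P)"
  then interpret P: principal_bundle G M P
    by blast
  let ?R = "restrict_bundle b P"
  have R: "principal_bundle_except_paracompact (stabilizer G b) M ?R"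
    by (rule P.principal_bundle_except_paracompact_restrict_bundle[OF assms(3,2,4)])
  have "paracompact_space (subtopology (total P) (topspace (total P) \<inter> {p. anchor P p = b}))"
    by (intro paracompact_space_closed_subtopology P.paracompact_total
        closedin_fibre[OF P.continuous_anchor P.Hausdorff_Obj])
  then have "paracompact_space (total ?R)"
    by (simp only: P.restrict_bundle_simps subtopology_restrict)
  with R have "principal_bundle (stabilizer G b) M ?R"
    by (simp add: principal_bundle_def principal_bundle_axioms_def)
  moreover have iso: "bundle_isomorphic G (extend_bundle G b ?R) P"
    by (rule P.bundle_isomorphic_extend_restrict[OF assms(3,2,4)])
  moreover have "principal_bundle_except_paracompact G M (extend_bundle G b ?R)"
    using assms(1,3) R
    by (intro stabilizer_bundle.principal_bundle_except_paracompact_extend)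
      (simp add: stabilizer_bundle_def stabilizer_bundle_axioms_def)
  then have "principal_bundle G M (extend_bundle G b ?R)"
    using bundle_isomorphic_paracompact_space[OF iso] P.paracompact_total
    by (simp add: principal_bundle_def principal_bundle_axioms_def)
  ultimately show "principal_bundle (stabilizer G b) M ?R \<and>
      principal_bundle G M (extend_bundle G b ?R) \<and> bundle_isomorphic G (extend_bundle G b ?R) P"
    by blast
next
  fix Q :: "('q, 'm, 'o, 'a) groupoid_bundle"
  assume "principal_bundle (stabilizer G b) M Q"
  then interpret Q: principal_bundle "stabilizer G b" M Q .
  interpret stabilizer_bundle G b M Q
    using assms(1,3) Q.principal_bundle_except_paracompact_axioms
    by (simp add: stabilizer_bundle_def stabilizer_bundle_axioms_def)
  have E: "principal_bundle_except_paracompact G M (extend_bundle G b Q)"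
    by (rule principal_bundle_except_paracompact_extend)
  have iso: "bundle_isomorphic (stabilizer G b) (restrict_bundle b (extend_bundle G b Q)) Q"
    by (rule bundle_isomorphic_restrict_extend[OF assms(2,4)])
  \<comment> \<open>The extension itself is not known to be paracompact here, so paracompactness of
    its anchor fibre is drawn from the isomorphism with \<open>Q\<close>.\<close>
  have "principal_bundle (stabilizer G b) M (restrict_bundle b (extend_bundle G b Q))"
    using principal_bundle_except_paracompact.principal_bundle_except_paracompact_restrict_bundle
        [OF E assms(3,2,4)] bundle_isomorphic_paracompact_space[OF iso] Q.paracompact_total
    by (simp add: principal_bundle_def principal_bundle_axioms_def)
  with E iso show "principal_bundle_except_paracompact G M (extend_bundle G b Q) \<and>
      (paracompact_space (total (extend_bundle G b Q)) \<longrightarrow>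
        principal_bundle G M (extend_bundle G b Q)) \<and>
      principal_bundle (stabilizer G b) M (restrict_bundle b (extend_bundle G b Q)) \<and>
      bundle_isomorphic (stabilizer G b) (restrict_bundle b (extend_bundle G b Q)) Q"
    by (simp add: principal_bundle_def principal_bundle_axioms_def)
qed

end
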